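(* The $(s,z,t)$-Temporal Separator problem is solvable in polynomial time on temporal graphs $G$ such that $G_\downarrow\setminus\{s,z\}$ is a tree.
   Context: A temporal graph $G=(V,E,\tau)$ consists of a finite vertex set $V$ and a set of time-labelled undirected edges $E \subseteq V\times V\times[\tau]$ ($(u,v,t')\in E$ iff $(v,u,t')\in E$, no loops); its underlying graph $G_\downarrow$ is the static graph on $V$ containing $\{u,v\}$ iff $(u,v,t')\in E$ for some $t'$, and $G_\downarrow\setminus\{s,z\}$ denotes it with $s,z$ deleted. An $(s,z)$-temporal path is a sequence of edges $(u_1,v_1,t_1),\dots,(u_k,v_k,t_k)$ forming a path from $s$ to $z$ with $t_1\le\dots\le t_k$; its travelling time is $t_k-t_1+1$, and it is an $(s,z,t)$-temporal path if this is at most $t$. An $(s,z,t)$-temporal separator is a set $S\subseteq V\setminus\{s,z\}$ meeting every $(s,z,t)$-temporal path. The $(s,z,t)$-Temporal Separator problem: given $G$, $s,z$, $t$, find a minimum-size $(s,z,t)$-temporal separator. *)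

theory Defs
  imports "HOL-Library.Log_Nat" "HOL-Computational_Algebra.Polynomial"
begin

section \<open>Static graphs and trees\<close>

record 'a sgraph =
  sverts :: "'a set"
  sedges :: "'a set set"

definition delete_verts :: "'a sgraph \<Rightarrow> 'a set \<Rightarrow> 'a sgraph" where
  "delete_verts H X =
     \<lparr>sverts = sverts H - X, sedges = {e \<in> sedges H. e \<inter> X = {}}\<rparr>"

definition is_walk :: "'a sgraph \<Rightarrow> 'a list \<Rightarrow> bool" where
  "is_walk H xs \<longleftrightarrow> xs \<noteq> [] \<and> set xs \<subseteq> sverts H \<and>
     (\<forall>i. Suc i < length xs \<longrightarrow> {xs ! i, xs ! Suc i} \<in> sedges H)"

definition is_connected :: "'a sgraph \<Rightarrow> bool" where
  "is_connected H \<longleftrightarrow> sverts H \<noteq> {} \<and>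
     (\<forall>u\<in>sverts H. \<forall>v\<in>sverts H. \<exists>xs. is_walk H xs \<and> hd xs = u \<and> last xs = v)"

text \<open>A cycle is listed without repeating its first vertex at the end.\<close>

definition is_cycle :: "'a sgraph \<Rightarrow> 'a list \<Rightarrow> bool" where
  "is_cycle H xs \<longleftrightarrow>
     is_walk H xs \<and> 3 \<le> length xs \<and> distinct xs \<and> {last xs, hd xs} \<in> sedges H"

definition is_tree :: "'a sgraph \<Rightarrow> bool" where
  "is_tree H \<longleftrightarrow> is_connected H \<and> (\<nexists>xs. is_cycle H xs)"


section \<open>Temporal graphs, temporal paths and separators\<close>

type_synonym 'a tedge = "'a \<times> 'a \<times> nat"

record 'a tgraph =
  tverts :: "'a set"
  tedges :: "'a tedge set"
  lifetime :: nat

definition temporal_graph :: "'a tgraph \<Rightarrow> bool" where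
  "temporal_graph G \<longleftrightarrow>
     finite (tverts G) \<and>
     tedges G \<subseteq> tverts G \<times> tverts G \<times> {1..lifetime G} \<and>
     (\<forall>u v i. (u, v, i) \<in> tedges G \<longleftrightarrow> (v, u, i) \<in> tedges G) \<and>
     (\<forall>v i. (v, v, i) \<notin> tedges G)"

definition underlying :: "'a tgraph \<Rightarrow> 'a sgraph" where
  "underlying G =
     \<lparr>sverts = tverts G, sedges = {{u, v} | u v. \<exists>i. (u, v, i) \<in> tedges G}\<rparr>"

definition src :: "'a tedge \<Rightarrow> 'a" where "src e = fst e"
definition tgt :: "'a tedge \<Rightarrow> 'a" where "tgt e = fst (snd e)"
definition label :: "'a tedge \<Rightarrow> nat" where "label e = snd (snd e)"

definition path_verts :: "'a tedge list \<Rightarrow> 'a list" where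
  "path_verts p = map src p @ [tgt (last p)]"

definition temporal_path :: "'a tgraph \<Rightarrow> 'a \<Rightarrow> 'a \<Rightarrow> 'a tedge list \<Rightarrow> bool" where
  "temporal_path G s z p \<longleftrightarrow>
     p \<noteq> [] \<and> set p \<subseteq> tedges G \<and>
     src (hd p) = s \<and> tgt (last p) = z \<and>
     (\<forall>i. Suc i < length p \<longrightarrow> tgt (p ! i) = src (p ! Suc i)) \<and>
     distinct (path_verts p) \<and>
     sorted (map label p)"

text \<open>On temporal paths the truncated subtraction is exact, as labels do not decrease.\<close>

definition travelling_time :: "'a tedge list \<Rightarrow> nat" where
  "travelling_time p = label (last p) - label (hd p) + 1"

definition temporal_path_within ::
    "'a tgraph \<Rightarrow> 'a \<Rightarrow> 'a \<Rightarrow> nat \<Rightarrow> 'a tedge list \<Rightarrow> bool" where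
  "temporal_path_within G s z t p \<longleftrightarrow> temporal_path G s z p \<and> travelling_time p \<le> t"

definition is_separator :: "'a tgraph \<Rightarrow> 'a \<Rightarrow> 'a \<Rightarrow> nat \<Rightarrow> 'a set \<Rightarrow> bool" where
  "is_separator G s z t S \<longleftrightarrow>
     S \<subseteq> tverts G - {s, z} \<and>
     (\<forall>p. temporal_path_within G s z t p \<longrightarrow> S \<inter> set (path_verts p) \<noteq> {})"

definition is_minimum_separator :: "'a tgraph \<Rightarrow> 'a \<Rightarrow> 'a \<Rightarrow> nat \<Rightarrow> 'a set \<Rightarrow> bool" where
  "is_minimum_separator G s z t S \<longleftrightarrow>
     is_separator G s z t S \<and> (\<forall>S'. is_separator G s z t S' \<longrightarrow> card S \<le> card S')"


section \<open>Machine model and polynomial time\<close>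

text \<open>
  Structured programs of a random access machine. The memory consists of arrays of natural
  numbers, a program referring to finitely many of them. The only arithmetic is addition
  and truncated subtraction, so in \<open>n\<close> steps numbers grow by \<open>O(n)\<close> bits and charging unit cost
  is polynomially equivalent to Turing machine time. (There is no multiplication; with it, unit
  cost would be too generous.) Expressions occurring in a fixed program have constant size,
  so evaluating them is not charged separately.
\<close>

type_synonym state = "nat \<Rightarrow> nat \<Rightarrow> nat"

datatype aexp = Const nat | Get nat aexp | Add aexp aexp | Sub aexp aexp

datatype bexp = Lt aexp aexp | Neg bexp | Conj bexp bexp

datatype com =
    Skip
  | Put nat aexp aexp  \<comment> \<open>\<open>Put a i e\<close> stores \<open>e\<close> in cell \<open>i\<close> of array \<open>a\<close>\<close>
  | Seq com com
  | Cond bexp com com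
  | Loop bexp com

primrec aval :: "aexp \<Rightarrow> state \<Rightarrow> nat" where
  "aval (Const k) \<sigma> = k"
| "aval (Get a i) \<sigma> = \<sigma> a (aval i \<sigma>)"
| "aval (Add e f) \<sigma> = aval e \<sigma> + aval f \<sigma>"
| "aval (Sub e f) \<sigma> = aval e \<sigma> - aval f \<sigma>"

primrec bval :: "bexp \<Rightarrow> state \<Rightarrow> bool" where
  "bval (Lt e f) \<sigma> \<longleftrightarrow> aval e \<sigma> < aval f \<sigma>"
| "bval (Neg b) \<sigma> \<longleftrightarrow> \<not> bval b \<sigma>"
| "bval (Conj b c) \<sigma> \<longleftrightarrow> bval b \<sigma> \<and> bval c \<sigma>"

text \<open>\<open>exec c \<sigma> n \<sigma>'\<close>: started in \<open>\<sigma>\<close>, the program \<open>c\<close> halts in \<open>\<sigma>'\<close> after \<open>n\<close> steps.\<close>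

inductive exec :: "com \<Rightarrow> state \<Rightarrow> nat \<Rightarrow> state \<Rightarrow> bool" where
  Skip: "exec Skip \<sigma> 1 \<sigma>"
| Put: "exec (Put a i e) \<sigma> 1 (\<sigma>(a := (\<sigma> a)(aval i \<sigma> := aval e \<sigma>)))"
| Seq: "exec c \<sigma> m \<sigma>' \<Longrightarrow> exec d \<sigma>' n \<sigma>'' \<Longrightarrow> exec (Seq c d) \<sigma> (m + n) \<sigma>''"
| CondTrue: "bval b \<sigma> \<Longrightarrow> exec c \<sigma> n \<sigma>' \<Longrightarrow> exec (Cond b c d) \<sigma> (n + 1) \<sigma>'"
| CondFalse: "\<not> bval b \<sigma> \<Longrightarrow> exec d \<sigma> n \<sigma>' \<Longrightarrow> exec (Cond b c d) \<sigma> (n + 1) \<sigma>'"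
| LoopFalse: "\<not> bval b \<sigma> \<Longrightarrow> exec (Loop b c) \<sigma> 1 \<sigma>"
| LoopTrue: "bval b \<sigma> \<Longrightarrow> exec c \<sigma> m \<sigma>' \<Longrightarrow> exec (Loop b c) \<sigma>' n \<sigma>''
    \<Longrightarrow> exec (Loop b c) \<sigma> (m + n + 1) \<sigma>''"

inductive_cases SkipE: "exec Skip \<sigma> n \<sigma>'"
inductive_cases PutE: "exec (Put a i e) \<sigma> n \<sigma>'"
inductive_cases SeqE: "exec (Seq c d) \<sigma> n \<sigma>'"
inductive_cases CondE: "exec (Cond b c d) \<sigma> n \<sigma>'"
inductive_cases LoopE: "exec (Loop b c) \<sigma> n \<sigma>'"

lemma exec_deterministic:
  "exec c \<sigma> n \<sigma>' \<Longrightarrow> exec c \<sigma> m \<sigma>'' \<Longrightarrow> n = m \<and> \<sigma>' = \<sigma>''"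
proof (induction arbitrary: m \<sigma>'' rule: exec.induct)
  case (Skip \<sigma>)
  then show ?case by (auto elim: SkipE)
next
  case (Put a i e \<sigma>)
  then show ?case by (auto elim: PutE)
next
  case (Seq c \<sigma> k \<sigma>1 d n \<sigma>2)
  from Seq.prems obtain k' \<sigma>' n' where m: "m = k' + n'"
    and e: "exec c \<sigma> k' \<sigma>'" "exec d \<sigma>' n' \<sigma>''"
    by (rule SeqE)
  from Seq.IH(1)[OF e(1)] have "k = k'" "\<sigma>1 = \<sigma>'" by simp_all
  moreover from this Seq.IH(2) e(2) have "n = n' \<and> \<sigma>2 = \<sigma>''" by simp
  ultimately show ?case using m by simp
next
  case (CondTrue b \<sigma> c n \<sigma>1 d)
  from CondTrue.prems CondTrue.hyps(1) obtain n' where "m = n' + 1" "exec c \<sigma> n' \<sigma>''"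
    by (auto elim: CondE)
  with CondTrue.IH show ?case by simp
next
  case (CondFalse b \<sigma> d n \<sigma>1 c)
  from CondFalse.prems CondFalse.hyps(1) obtain n' where "m = n' + 1" "exec d \<sigma> n' \<sigma>''"
    by (auto elim: CondE)
  with CondFalse.IH show ?case by simp
next
  case (LoopFalse b \<sigma> c)
  from LoopFalse.prems LoopFalse.hyps show ?case by (auto elim: LoopE)
next
  case (LoopTrue b \<sigma> c k \<sigma>1 n \<sigma>2)
  from LoopTrue.prems LoopTrue.hyps(1) obtain k' \<sigma>' n' where m: "m = k' + n' + 1"
    and e: "exec c \<sigma> k' \<sigma>'" "exec (Loop b c) \<sigma>' n' \<sigma>''"
    by (rule_tac LoopE) auto
  from LoopTrue.IH(1)[OF e(1)] have "k = k'" "\<sigma>1 = \<sigma>'" by simp_all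
  moreover from this LoopTrue.IH(2) e(2) have "n = n' \<and> \<sigma>2 = \<sigma>''" by simp
  ultimately show ?case using m by simp
qed

text \<open>
  Input and output are lists of numbers: array 0 holds the entries and cell 0 of array 1 holds
  the length. All other cells are initially 0.
\<close>

definition load :: "nat list \<Rightarrow> state" where
  "load xs = (\<lambda>a i. if a = 0 \<and> i < length xs then xs ! i
                    else if a = 1 \<and> i = 0 then length xs else 0)"

definition result :: "state \<Rightarrow> nat list" where
  "result \<sigma> = map (\<sigma> 0) [0..<\<sigma> 1 0]"

text \<open>The size of an input is its length in binary, with one further bit per number.\<close>

definition input_size :: "nat list \<Rightarrow> nat" where
  "input_size xs = (\<Sum>x\<leftarrow>xs. floorlog 2 x + 1)"

text \<open>
  A search problem is given by the admissible instances \<open>D\<close>, the codes \<open>enc I\<close> of an instance \<open>I\<close>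
  and its correct answers \<open>ans I\<close>. The length of the output is charged too, because a program could
  announce a huge output without writing it.
\<close>

definition poly_time_solvable ::
    "'i set \<Rightarrow> ('i \<Rightarrow> nat list set) \<Rightarrow> ('i \<Rightarrow> nat list set) \<Rightarrow> bool" where
  "poly_time_solvable D enc ans \<longleftrightarrow>
     (\<exists>(c :: com) (p :: nat poly). \<forall>I\<in>D. \<forall>xs\<in>enc I. \<exists>n \<sigma>.
        exec c (load xs) n \<sigma> \<and> result \<sigma> \<in> ans I \<and>
        n + length (result \<sigma>) \<le> poly p (input_size xs))"


section \<open>The temporal separator problem\<close>

type_synonym separator_instance = "nat tgraph \<times> nat \<times> nat \<times> nat"

definition separator_instances :: "separator_instance set" where
  "separator_instances =
     {(G, s, z, t). temporal_graph G \<and> s \<in> tverts G \<and> z \<in> tverts G \<and> s \<noteq> z}"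

text \<open>
  The vertices and the time-labelled edges (each in both orientations) may be listed in any order.
\<close>

definition separator_codes :: "separator_instance \<Rightarrow> nat list set" where
  "separator_codes = (\<lambda>(G, s, z, t).
     {[lifetime G, s, z, t, length vs, length es] @ vs @ concat (map (\<lambda>(u, v, i). [u, v, i]) es)
      | vs es. distinct vs \<and> set vs = tverts G \<and> distinct es \<and> set es = tedges G})"

text \<open>
  No separator exists exactly if some path within the time bound consists of a single edge from \<open>s\<close> to \<open>z\<close>;
  then the answer is \<open>[0]\<close>. Otherwise it is \<open>1\<close> followed by the elements of a minimum separator.
\<close>

definition separator_answers :: "separator_instance \<Rightarrow> nat list set" where
  "separator_answers = (\<lambda>(G, s, z, t).
     {1 # ws | ws. distinct ws \<and> is_minimum_separator G s z t (set ws)} \<union>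
     (if \<exists>S. is_separator G s z t S then {} else {[0]}))"

end

theory Submission
  imports Defs
begin

text \<open>
  Every temporal path from \<open>s\<close> to \<open>z\<close> runs, between its ends, along a path of the tree, so a separator
  is a hitting set for a family of subtrees. Such a family has a greedy optimal hitting set: process
  the vertices bottom-up and choose a vertex exactly if, together with the processed vertices that
  were not chosen, it completes a member of the family, whose top it then is. If two subtrees
  intersect, the deeper of their tops lies in the other one; hence the subtrees that forced the
  choices are pairwise disjoint, and every hitting set needs an element in each.

  A bottom-up order is the reverse of any search order: as the tree has no cycle, each vertex has a
  unique neighbour that was found earlier. The test whether a set of allowed vertices contains a
  temporal path within the time bound is a Bellman-Ford computation of earliest arrival times, repeated
  for the label of each edge as the starting time. (Iterating over all starting times up to the
  lifetime would take exponentially many steps.)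
\<close>

section \<open>Temporal paths by extension\<close>

text \<open>A separator can hit a path only strictly between \<open>s\<close> and \<open>z\<close>,
  and the vertices there are exactly the sources of its edges other than \<open>s\<close>. So
  allowed vertices are tested on sources alone, and \<open>z\<close> is never marked. A path that is
  a single edge has an empty interior, which nothing hits; hence the reachability test run with
  \<open>s\<close> alone decides whether a separator exists at all. Temporal paths are defined by
  indices, whereas earliest arrivals and the connectivity argument both extend a path at its end;
  \<open>tpath\<close> therefore grows by a last edge. It also fixes the starting time
  \<open>lo\<close> in advance: this turns the bound on a difference of times into the deadline
  \<open>lo + t\<close>, and for a common \<open>lo\<close> an earlier arrival is never worse, which
  fails if only travelling times are compared. Relaxation may run back into a vertex of the path
  found so far, but a temporal path repeats no vertex; cutting the path at that vertex repairs this.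
  Running times are expressed by a bound \<open>L\<close> on the two list lengths; the magnitude of
  the numbers never enters, as every machine operation has unit cost.\<close>

text \<open>
  \<open>tpath E s lo v x p\<close>: the path \<open>p\<close> starts from \<open>s\<close> at time \<open>lo\<close> and arrives at \<open>v\<close> at time \<open>x\<close>.
\<close>

inductive tpath :: "'a tedge set \<Rightarrow> 'a \<Rightarrow> nat \<Rightarrow> 'a \<Rightarrow> nat \<Rightarrow> 'a tedge list \<Rightarrow> bool"
  for E s lo where
  tpath_Nil: "tpath E s lo s lo []"
| tpath_snoc: "tpath E s lo v x p \<Longrightarrow> (v, w, i) \<in> E \<Longrightarrow> x \<le> i \<Longrightarrow> w \<notin> insert s (tgt ` set p)
    \<Longrightarrow> tpath E s lo w i (p @ [(v, w, i)])"

lemma tedge_sels [simp]: "src (u, v, i) = u" "tgt (u, v, i) = v" "label (u, v, i) = i"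
  by (simp_all add: src_def tgt_def label_def)

lemma tedge_collapse: "(src e, tgt e, label e) = e"
  by (simp add: src_def tgt_def label_def)

lemma tpath_Nil_iff: "tpath E s lo v x [] \<longleftrightarrow> v = s \<and> x = lo"
  by (subst tpath.simps) auto

lemma tpath_at_source: "tpath E s lo s x p \<Longrightarrow> p = []"
  by (erule tpath.cases) auto

lemma tpath_end: "tpath E s lo v x p \<Longrightarrow> v \<in> insert s (tgt ` set p)"
  by (induction rule: tpath.induct) auto

lemma tpath_edges: "tpath E s lo v x p \<Longrightarrow> set p \<subseteq> E"
  by (induction rule: tpath.induct) auto

lemma tpath_distinct: "tpath E s lo v x p \<Longrightarrow> distinct p"
proof (induction rule: tpath.induct)
  case (tpath_snoc v x p w i)
  then have "(v, w, i) \<notin> set p" by force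
  with tpath_snoc show ?case by simp
qed simp

text \<open>Labels do not decrease, so cutting a path at a vertex it visits gives an arrival that is
  no later. This is used when a relaxed edge leads back to a vertex already on the path.\<close>

lemma tpath_prefix:
  assumes "tpath E s lo v x p" "w \<in> insert s (tgt ` set p)"
  shows "\<exists>p' x'. tpath E s lo w x' p' \<and> x' \<le> x \<and> set p' \<subseteq> set p"
  using assms
proof (induction rule: tpath.induct)
  case tpath_Nil
  then show ?case using tpath.tpath_Nil by fastforce
next
  case (tpath_snoc v x p u i)
  show ?case
  proof (cases "w = u")
    case True
    with tpath.tpath_snoc[OF tpath_snoc.hyps] show ?thesis by blast
  next
    case False
    with tpath_snoc obtain p' x' where "tpath E s lo w x' p'" "x' \<le> x" "set p' \<subseteq> set p"
      by auto
    with \<open>x \<le> i\<close> show ?thesis by (intro exI[of _ p'] exI[of _ x']) auto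
  qed
qed

text \<open>Waiting at \<open>s\<close> before the first edge is irrelevant: the start may be
  postponed to the label of that edge. Hence it suffices to try labels that occur on edges as
  starting times.\<close>

lemma tpath_restart:
  "tpath E s lo v x p \<Longrightarrow> p \<noteq> [] \<Longrightarrow> tpath E s (label (hd p)) v x p \<and> lo \<le> label (hd p)"
proof (induction rule: tpath.induct)
  case (tpath_snoc v x p w i)
  show ?case
  proof (cases "p = []")
    case True
    with tpath_snoc have "v = s" "x = lo" by (simp_all add: tpath_Nil_iff)
    moreover have "tpath E s i w i ([] @ [(s, w, i)])"
      using tpath_snoc \<open>v = s\<close> True by (intro tpath.tpath_snoc[OF tpath.tpath_Nil]) auto
    ultimately show ?thesis using tpath_snoc True by simp
  next
    case False
    with tpath_snoc show ?thesis by (auto intro: tpath.tpath_snoc)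
  qed
qed simp

lemma path_verts_snoc: "p \<noteq> [] \<Longrightarrow> tgt (last p) = src e \<Longrightarrow>
    path_verts (p @ [e]) = path_verts p @ [tgt e]"
  by (simp add: path_verts_def)

lemma tpath_path_verts:
  "tpath E s lo v x p \<Longrightarrow> p \<noteq> [] \<Longrightarrow> set (path_verts p) = insert s (tgt ` set p)"
proof (induction rule: tpath.induct)
  case (tpath_snoc v x p w i)
  then show ?case
  proof (cases "p = []")
    case True
    with tpath_snoc show ?thesis by (simp add: path_verts_def tpath_Nil_iff)
  next
    case False
    from tpath_snoc.hyps(1) False have "tgt (last p) = v" by (cases rule: tpath.cases) auto
    with False tpath_snoc show ?thesis by (auto simp: path_verts_snoc)
  qed
qed simp

lemma tpath_imp_temporal_path:
  "tpath (tedges G) s lo v x p \<Longrightarrow> p \<noteq> [] \<Longrightarrow>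
     temporal_path G s v p \<and> label (last p) = x \<and> (\<forall>e\<in>set p. label e \<le> x)"
proof (induction rule: tpath.induct)
  case (tpath_snoc v x p w i)
  show ?case
  proof (cases "p = []")
    case True
    with tpath_snoc show ?thesis
      by (auto simp: temporal_path_def path_verts_def tpath_Nil_iff)
  next
    case False
    with tpath_snoc.IH have IH: "temporal_path G s v p" "label (last p) = x"
      "\<forall>e\<in>set p. label e \<le> x" by auto
    have "distinct (path_verts (p @ [(v, w, i)]))"
      using IH False tpath_path_verts[OF tpath_snoc.hyps(1) False] tpath_snoc.hyps(4)
      by (simp add: path_verts_snoc temporal_path_def)
    moreover have "tgt ((p @ [(v, w, i)]) ! j) = src ((p @ [(v, w, i)]) ! Suc j)"
      if "Suc j < length (p @ [(v, w, i)])" for j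
      using IH False that
      by (cases "Suc j = length p") (auto simp: nth_append temporal_path_def last_conv_nth
          dest!: arg_cong[of "Suc j" _ "\<lambda>k. k - 1"])
    ultimately show ?thesis
      using IH False tpath_snoc.hyps
      by (auto simp: temporal_path_def sorted_append intro: order_trans)
  qed
qed simp

lemma temporal_path_imp_tpath:
  "temporal_path G s v p \<Longrightarrow> tpath (tedges G) s (label (hd p)) v (label (last p)) p"
proof (induction p arbitrary: v rule: rev_induct)
  case Nil
  then show ?case by (simp add: temporal_path_def)
next
  case (snoc e p)
  obtain u w i where e: "e = (u, w, i)" by (cases e) auto
  show ?case
  proof (cases "p = []")
    case True
    with snoc.prems e have "tpath (tedges G) s i v i ([] @ [(s, v, i)])"
      by (intro tpath_snoc[OF tpath_Nil]) (auto simp: temporal_path_def path_verts_def)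
    with True snoc.prems e show ?thesis by (simp add: temporal_path_def)
  next
    case False
    have u: "tgt (last p) = u"
      using snoc.prems[unfolded temporal_path_def] False e
      by (auto simp: last_conv_nth nth_append dest!: spec[of _ "length p - 1"])
    have adj: "tgt (p ! i) = src (p ! Suc i)" if "Suc i < length p" for i
    proof -
      have "Suc i < length (p @ [e])" using that by simp
      with snoc.prems have "tgt ((p @ [e]) ! i) = src ((p @ [e]) ! Suc i)"
        unfolding temporal_path_def by blast
      with that show ?thesis by (simp add: nth_append)
    qed
    have "temporal_path G s u p"
      using snoc.prems False u e adj
      by (auto simp: temporal_path_def path_verts_snoc sorted_append)
    with snoc.IH have *: "tpath (tedges G) s (label (hd p)) u (label (last p)) p" .
    have "tpath (tedges G) s (label (hd p)) w i (p @ [(u, w, i)])"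
      using snoc.prems False e u tpath_path_verts[OF * False]
      by (intro tpath_snoc[OF *]) (auto simp: temporal_path_def path_verts_snoc sorted_append)
    with False snoc.prems e show ?thesis by (simp add: temporal_path_def)
  qed
qed

text \<open>\<open>A\<close> constrains the sources of the edges, that is, all vertices of the path
  except \<open>z\<close>. The condition \<open>x < lo + t\<close> bounds the travelling time
  without subtraction and also treats \<open>t = 0\<close> correctly, where no path
  qualifies.\<close>

definition reaches :: "'a tedge set \<Rightarrow> 'a \<Rightarrow> 'a \<Rightarrow> nat \<Rightarrow> 'a set \<Rightarrow> bool" where
  "reaches E s z t A \<longleftrightarrow>
     (\<exists>lo x p. tpath E s lo z x p \<and> x < lo + t \<and> src ` set p \<subseteq> A)"

text \<open>From right to left, \<open>lo\<close> may lie before the first label; the actual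
  travelling time is then only shorter than the window.\<close>

lemma temporal_path_within_iff_tpath:
  assumes "s \<noteq> z"
  shows "temporal_path_within G s z t p \<longleftrightarrow>
    (\<exists>lo x. tpath (tedges G) s lo z x p \<and> x < lo + t)"
proof
  assume "temporal_path_within G s z t p"
  then have p: "temporal_path G s z p" and tt: "travelling_time p \<le> t"
    by (auto simp: temporal_path_within_def)
  show "\<exists>lo x. tpath (tedges G) s lo z x p \<and> x < lo + t"
    using temporal_path_imp_tpath[OF p] tt by (force simp: travelling_time_def)
next
  assume "\<exists>lo x. tpath (tedges G) s lo z x p \<and> x < lo + t"
  then obtain lo x where *: "tpath (tedges G) s lo z x p" "x < lo + t" by auto
  then have ne: "p \<noteq> []" using assms by (auto simp: tpath_Nil_iff)
  have "lo \<le> label (hd p)" using tpath_restart[OF *(1) ne] by simp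
  moreover have "label (hd p) \<le> x" using tpath_imp_temporal_path[OF *(1) ne] ne by auto
  ultimately show "temporal_path_within G s z t p"
    using tpath_imp_temporal_path[OF *(1) ne] * unfolding temporal_path_within_def
    by (auto simp: travelling_time_def)
qed

text \<open>Every vertex of the path but \<open>z\<close> is a source and \<open>S\<close> avoids
  \<open>z\<close>, so a path is missed by \<open>S\<close> exactly if all its sources lie in the
  complement.\<close>

lemma is_separator_iff_not_reaches:
  assumes "s \<noteq> z"
  shows "is_separator G s z t S \<longleftrightarrow>
    S \<subseteq> tverts G - {s, z} \<and> \<not> reaches (tedges G) s z t (- S)"
proof -
  have "S \<inter> set (path_verts p) = {} \<longleftrightarrow> src ` set p \<subseteq> - S"
    if "S \<subseteq> tverts G - {s, z}" "temporal_path_within G s z t p" for p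
    using that by (auto simp: path_verts_def temporal_path_within_def temporal_path_def)
  then show ?thesis
    unfolding is_separator_def reaches_def temporal_path_within_iff_tpath[OF assms] by blast
qed

lemma reaches_mono: "reaches E s z t A \<Longrightarrow> A \<subseteq> B \<Longrightarrow> reaches E s z t B"
  unfolding reaches_def by blast

section \<open>Search orders\<close>

text \<open>Neither breadth-first nor depth-first: a new vertex merely has some earlier neighbour.
  Repeated scans of the edge list guarantee just this, and it is enough for a rooted tree in which
  parents precede children.\<close>

inductive search_order :: "'a sgraph \<Rightarrow> 'a list \<Rightarrow> bool" for H where
  search_order_root: "r \<in> sverts H \<Longrightarrow> search_order H [r]"
| search_order_snoc: "search_order H ws \<Longrightarrow> u \<in> set ws \<Longrightarrow> v \<in> sverts H \<Longrightarrow> v \<notin> set ws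
    \<Longrightarrow> {u, v} \<in> sedges H \<Longrightarrow> search_order H (ws @ [v])"

lemma search_order_distinct: "search_order H ws \<Longrightarrow> distinct ws"
  by (induction rule: search_order.induct) auto

lemma search_order_verts: "search_order H ws \<Longrightarrow> ws \<noteq> [] \<and> set ws \<subseteq> sverts H"
  by (induction rule: search_order.induct) auto

lemma is_walk_Cons:
  "is_walk H xs \<Longrightarrow> v \<in> sverts H \<Longrightarrow> {v, hd xs} \<in> sedges H \<Longrightarrow> is_walk H (v # xs)"
  unfolding is_walk_def by (auto simp: nth_Cons hd_conv_nth split: nat.splits)

lemma is_walk_snoc:
  "is_walk H xs \<Longrightarrow> v \<in> sverts H \<Longrightarrow> {last xs, v} \<in> sedges H \<Longrightarrow> is_walk H (xs @ [v])"
  unfolding is_walk_def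
proof (intro conjI allI impI)
  fix i
  assume a: "xs \<noteq> [] \<and> set xs \<subseteq> sverts H \<and> (\<forall>i. Suc i < length xs \<longrightarrow> {xs ! i, xs ! Suc i} \<in> sedges H)"
    "v \<in> sverts H" "{last xs, v} \<in> sedges H" "Suc i < length (xs @ [v])"
  show "{(xs @ [v]) ! i, (xs @ [v]) ! Suc i} \<in> sedges H"
  proof (cases "Suc i < length xs")
    case True
    with a show ?thesis by (simp add: nth_append)
  next
    case False
    with a have "length xs = Suc i" by simp
    with a(1,3) show ?thesis by (auto simp: nth_append last_conv_nth)
  qed
qed auto

lemma search_order_connected:
  assumes "search_order H ws" "a \<in> set ws" "b \<in> set ws"
  shows "\<exists>xs. is_walk H xs \<and> distinct xs \<and> set xs \<subseteq> set ws \<and> hd xs = a \<and> last xs = b"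
  using assms
proof (induction arbitrary: a b rule: search_order.induct)
  case (search_order_root r)
  then show ?case by (intro exI[of _ "[r]"]) (auto simp: is_walk_def)
next
  case (search_order_snoc ws u v)
  consider "a = v" "b = v" | "a = v" "b \<in> set ws" | "a \<in> set ws" "b = v"
    | "a \<in> set ws" "b \<in> set ws"
    using search_order_snoc.prems by auto
  then show ?case
  proof cases
    case 1
    then show ?thesis using search_order_snoc.hyps
      by (intro exI[of _ "[v]"]) (auto simp: is_walk_def)
  next
    case 2
    from search_order_snoc.IH[OF search_order_snoc.hyps(2) 2(2)] obtain xs where xs:
      "is_walk H xs" "distinct xs" "set xs \<subseteq> set ws" "hd xs = u" "last xs = b" by blast
    then have "xs \<noteq> []" by (simp add: is_walk_def)
    with xs 2 search_order_snoc.hyps show ?thesis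
      by (intro exI[of _ "v # xs"])
        (auto intro!: is_walk_Cons simp: insert_commute)
  next
    case 3
    from search_order_snoc.IH[OF 3(1) search_order_snoc.hyps(2)] obtain xs where xs:
      "is_walk H xs" "distinct xs" "set xs \<subseteq> set ws" "hd xs = a" "last xs = u" by blast
    then have "xs \<noteq> []" by (simp add: is_walk_def)
    with xs 3 search_order_snoc.hyps show ?thesis
      by (intro exI[of _ "xs @ [v]"])
        (auto intro!: is_walk_snoc simp: insert_commute)
  next
    case 4
    from search_order_snoc.IH[OF 4] obtain xs where
      "is_walk H xs" "distinct xs" "set xs \<subseteq> set ws" "hd xs = a" "last xs = b" by blast
    then show ?thesis by (intro exI[of _ xs]) auto
  qed
qed

text \<open>Two earlier neighbours of a vertex would be joined by a simple path inside the earlier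
  part of the order, and the vertex would close this path to a cycle.\<close>

lemma search_order_unique_earlier_neighbour:
  assumes "search_order H ws" "\<nexists>xs. is_cycle H xs" "i < length ws" "j < i" "k < i"
    "{ws ! i, ws ! j} \<in> sedges H" "{ws ! i, ws ! k} \<in> sedges H"
  shows "j = k"
  using assms
proof (induction arbitrary: i j k rule: search_order.induct)
  case (search_order_root r)
  then show ?case by simp
next
  case (search_order_snoc ws u v)
  show ?case
  proof (cases "i < length ws")
    case True
    show ?thesis
      by (rule search_order_snoc.IH[of i])
        (use True search_order_snoc.prems in \<open>simp_all add: nth_append\<close>)
  next
    case False
    with search_order_snoc.prems have i: "i = length ws" by simp
    show ?thesis
    proof (rule ccontr)
      assume "j \<noteq> k"
      with i search_order_snoc.prems search_order_distinct[OF search_order_snoc.hyps(1)]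
      have ne: "ws ! j \<noteq> ws ! k" by (auto simp: nth_eq_iff_index_eq)
      have "ws ! j \<in> set ws" "ws ! k \<in> set ws" using i search_order_snoc.prems by auto
      from search_order_connected[OF search_order_snoc.hyps(1) this]
      obtain xs where xs: "is_walk H xs" "distinct xs" "set xs \<subseteq> set ws"
        "hd xs = ws ! j" "last xs = ws ! k" by blast
      have "is_cycle H (xs @ [v])"
        unfolding is_cycle_def
      proof (intro conjI)
        show "is_walk H (xs @ [v])"
          using xs search_order_snoc.prems search_order_snoc.hyps i
          by (intro is_walk_snoc) (auto simp: nth_append insert_commute)
        have "xs \<noteq> []" using xs(1) by (simp add: is_walk_def)
        \<comment> \<open>The ends of \<open>xs\<close> differ, so \<open>xs\<close> has at least
          two vertices and the cycle through \<open>v\<close> at least three.\<close>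
        moreover have "length xs \<noteq> 1" using xs ne by (auto simp: length_Suc_conv)
        ultimately show "3 \<le> length (xs @ [v])" by (cases xs) (auto simp: Suc_le_eq)
        show "distinct (xs @ [v])" using xs search_order_snoc.hyps by auto
        show "{last (xs @ [v]), hd (xs @ [v])} \<in> sedges H"
          using xs \<open>xs \<noteq> []\<close> search_order_snoc.prems i by (simp add: nth_append)
      qed
      with search_order_snoc.prems(1) show False by blast
    qed
  qed
qed

lemma connected_closed_subset:
  assumes "is_connected H" "r \<in> W" "r \<in> sverts H"
    and closed: "\<And>u v. u \<in> W \<Longrightarrow> v \<in> sverts H \<Longrightarrow> {u, v} \<in> sedges H \<Longrightarrow> v \<in> W"
  shows "sverts H \<subseteq> W"
proof
  fix v assume v: "v \<in> sverts H"
  with assms obtain xs where xs: "is_walk H xs" "hd xs = r" "last xs = v"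
    unfolding is_connected_def by blast
  have "i < length xs \<Longrightarrow> xs ! i \<in> W" for i
  proof (induction i)
    case 0
    then show ?case using xs assms(2) by (simp add: hd_conv_nth is_walk_def)
  next
    case (Suc i)
    then show ?case using xs(1) by (intro closed[of "xs ! i" "xs ! Suc i"]) (auto simp: is_walk_def)
  qed
  from this[of "length xs - 1"] xs show "v \<in> W" by (auto simp: is_walk_def last_conv_nth)
qed

section \<open>Greedy hitting sets\<close>

text \<open>
  The relation \<open>par\<close> sends a vertex to its parent; since it is single-valued, the ascending chain from
  \<open>x\<close> to \<open>v\<close> passes through every ancestor \<open>w\<close> of \<open>x\<close> that is still below \<open>v\<close>.
\<close>

lemma min_rank_meets:
  fixes rk :: "'a \<Rightarrow> nat"
  assumes par: "single_valued par" "\<And>x y. (x, y) \<in> par \<Longrightarrow> rk y < rk x"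
    and X: "(x, v) \<in> (par \<inter> X \<times> X)\<^sup>*" "x \<in> X"
    and w: "(x, w) \<in> par\<^sup>*" "rk v < rk w"
  shows "w \<in> X"
  using X w
proof (induction rule: converse_rtrancl_induct)
  case base
  have "(v, w) \<in> par\<^sup>* \<Longrightarrow> rk w \<le> rk v"
    by (induction rule: rtrancl_induct) (auto dest: par(2) intro: order_trans)
  with base show ?case by auto
next
  case (step y y')
  from step.prems(2) show ?case
  proof (cases rule: converse_rtranclE)
    case base
    with step show ?thesis by simp
  next
    case (step y'')
    with \<open>(y, y') \<in> par \<inter> X \<times> X\<close> par(1) have "y'' = y'" by (auto dest: single_valuedD)
    with step \<open>(y, y') \<in> par \<inter> X \<times> X\<close> \<open>rk v < rk w\<close> show ?thesis
      using \<open>y' \<in> X \<Longrightarrow> (y', w) \<in> par\<^sup>* \<Longrightarrow> rk v < rk w \<Longrightarrow> w \<in> X\<close> by blast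
  qed
qed

text \<open>Connectivity by cuts: no proper nonempty part is closed under adjacency. For the
  interior of a path this needs only that consecutive vertices are adjacent, so no walk has to be
  extracted. The empty set qualifies, as it must for paths with a single edge.\<close>

definition cut_connected :: "('a \<Rightarrow> 'a \<Rightarrow> bool) \<Rightarrow> 'a set \<Rightarrow> bool" where
  "cut_connected adj X \<longleftrightarrow>
     (\<forall>U. U \<subseteq> X \<and> U \<noteq> {} \<and> (\<forall>a\<in>X. \<forall>b\<in>X. adj a b \<longrightarrow> (a \<in> U \<longleftrightarrow> b \<in> U)) \<longrightarrow> U = X)"

text \<open>The vertices that reach \<open>v\<close> by parent steps inside \<open>X\<close> are
  closed under adjacency in \<open>X\<close>. A neighbour of larger rank is a child and prepends one
  step; a neighbour of smaller rank is the parent.\<close>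

lemma cut_connected_descends_to_minimum:
  fixes rk :: "'a \<Rightarrow> nat"
  assumes "cut_connected adj X" "symp adj" "inj_on rk X" "v \<in> X" "\<And>y. y \<in> X \<Longrightarrow> rk v \<le> rk y"
    and par: "par = {(a, b). adj a b \<and> rk b < rk a \<and> a \<in> V \<and> b \<in> V}" "X \<subseteq> V" "single_valued par"
    and x: "x \<in> X" and irr: "\<And>a. \<not> adj a a"
  shows "(x, v) \<in> (par \<inter> X \<times> X)\<^sup>*"
proof -
  define U where "U = {y \<in> X. (y, v) \<in> (par \<inter> X \<times> X)\<^sup>*}"
  have *: "b \<in> U" if ab: "a \<in> U" "b \<in> X" "adj a b" for a b
  proof (cases "rk a < rk b")
    case True
    with ab par assms(2) have "(b, a) \<in> par \<inter> X \<times> X" by (auto simp: U_def dest: sympD)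
    with ab show ?thesis by (auto simp: U_def intro: converse_rtrancl_into_rtrancl)
  next
    case False
    have "a \<noteq> b" using irr ab by auto
    with False ab assms(3) have lt: "rk b < rk a"
      by (metis (no_types, lifting) U_def inj_onD linorder_neqE_nat mem_Collect_eq)
    with ab par have pb: "(a, b) \<in> par" by (auto simp: U_def)
    from ab have "(a, v) \<in> (par \<inter> X \<times> X)\<^sup>*" by (simp add: U_def)
    then show ?thesis
    proof (cases rule: converse_rtranclE)
      case base
      with lt assms(5)[OF ab(2)] show ?thesis by simp
    next
      \<comment> \<open>The chain from \<open>a\<close> starts with its only parent, and
        \<open>b\<close> is that parent; so the rest of the chain serves for
        \<open>b\<close>.\<close>
      case (step c)
      with pb par(3) have "c = b" by (auto dest: single_valuedD)
      with step ab show ?thesis by (simp add: U_def)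
    qed
  qed
  have "U = X"
    using assms(1) unfolding cut_connected_def
  proof (elim allE impE)
    show "U \<subseteq> X \<and> U \<noteq> {} \<and> (\<forall>a\<in>X. \<forall>b\<in>X. adj a b \<longrightarrow> (a \<in> U) = (b \<in> U))"
      using * assms(2,4) by (auto simp: U_def dest: sympD)
  qed
  with x show ?thesis by (auto simp: U_def)
qed

text \<open>
  \<open>A\<close> are the processed vertices that were not chosen, \<open>S\<close> the chosen ones; \<open>f\<close> assigns to each chosen
  vertex the set that forced the choice. These sets are disjoint, so no hitting set is smaller than \<open>S\<close>.
\<close>

definition greedy_inv :: "'a set set \<Rightarrow> ('a \<Rightarrow> nat) \<Rightarrow> 'a set \<Rightarrow> 'a set \<Rightarrow> bool" where
  "greedy_inv F rk A S \<longleftrightarrow> A \<inter> S = {} \<and> (\<forall>X\<in>F. \<not> X \<subseteq> A) \<and>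
     (\<exists>f. \<forall>w\<in>S. f w \<in> F \<and> w \<in> f w \<and> (\<forall>y\<in>f w. rk w \<le> rk y) \<and>
        (\<forall>w'\<in>S. w \<noteq> w' \<longrightarrow> f w \<inter> f w' = {}))"

lemma greedy_inv_keep:
  "greedy_inv F rk A S \<Longrightarrow> v \<notin> S \<Longrightarrow> \<forall>X\<in>F. \<not> X \<subseteq> insert v A \<Longrightarrow> greedy_inv F rk (insert v A) S"
  unfolding greedy_inv_def by blast

text \<open>Everything in \<open>X\<close> besides \<open>v\<close> was processed earlier and has
  larger rank, so \<open>v\<close> is the top of \<open>X\<close>. If a previous forcing set met
  \<open>X\<close>, its deeper top \<open>w\<close> would lie in \<open>X\<close> by
  \<open>meet\<close>; but \<open>X\<close> contains no chosen vertex other than \<open>v\<close>.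
  The tree enters through \<open>meet\<close> alone.\<close>

lemma greedy_inv_take:
  assumes inv: "greedy_inv F rk A S" and v: "v \<notin> A" "v \<notin> S" "\<And>y. y \<in> A \<union> S \<Longrightarrow> rk v < rk y"
    and X: "X \<in> F" "X \<subseteq> insert v A"
    and meet: "\<And>X Y w. X \<in> F \<Longrightarrow> Y \<in> F \<Longrightarrow> v \<in> X \<Longrightarrow> (\<And>y. y \<in> X \<Longrightarrow> rk v \<le> rk y) \<Longrightarrow>
      w \<in> Y \<Longrightarrow> (\<And>y. y \<in> Y \<Longrightarrow> rk w \<le> rk y) \<Longrightarrow> rk v < rk w \<Longrightarrow> X \<inter> Y \<noteq> {} \<Longrightarrow> w \<in> X"
  shows "greedy_inv F rk A (insert v S)"
proof -
  from inv obtain f where f: "\<And>w. w \<in> S \<Longrightarrow> f w \<in> F \<and> w \<in> f w \<and> (\<forall>y\<in>f w. rk w \<le> rk y) \<and>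
      (\<forall>w'\<in>S. w \<noteq> w' \<longrightarrow> f w \<inter> f w' = {})" and A: "A \<inter> S = {}" "\<forall>X\<in>F. \<not> X \<subseteq> A"
    unfolding greedy_inv_def by metis
  have vX: "v \<in> X" using A X by auto
  have Xmin: "rk v \<le> rk y" if "y \<in> X" for y using X v that by (force intro: less_imp_le)
  have disj: "f w \<inter> X = {}" if w: "w \<in> S" for w
  proof (rule ccontr)
    assume "f w \<inter> X \<noteq> {}"
    then have "w \<in> X" using f[OF w] w v(3) by (intro meet[OF X(1) _ vX Xmin, of "f w" w]) auto
    with X(2) A(1) w v(2) show False by blast
  qed
  have "\<forall>w\<in>insert v S. (f(v := X)) w \<in> F \<and> w \<in> (f(v := X)) w \<and>
      (\<forall>y\<in>(f(v := X)) w. rk w \<le> rk y) \<and>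
      (\<forall>w'\<in>insert v S. w \<noteq> w' \<longrightarrow> (f(v := X)) w \<inter> (f(v := X)) w' = {})"
  proof
    fix w assume "w \<in> insert v S"
    then consider "w = v" | "w \<in> S" "w \<noteq> v" using v(2) by auto
    then show "(f(v := X)) w \<in> F \<and> w \<in> (f(v := X)) w \<and>
      (\<forall>y\<in>(f(v := X)) w. rk w \<le> rk y) \<and>
      (\<forall>w'\<in>insert v S. w \<noteq> w' \<longrightarrow> (f(v := X)) w \<inter> (f(v := X)) w' = {})"
    proof cases
      case 1
      with X(1) vX Xmin disj show ?thesis by (simp add: Int_commute)
    next
      case 2
      with f[OF 2(1)] disj[OF 2(1)] show ?thesis by simp
    qed
  qed
  moreover have "A \<inter> insert v S = {}" using A(1) v(1) by blast
  ultimately show ?thesis using A(2) unfolding greedy_inv_def by blast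
qed

text \<open>Selecting an element of \<open>S'\<close> from the forcing set of each chosen vertex is
  injective, because these sets are disjoint.\<close>

lemma greedy_inv_minimum:
  assumes "greedy_inv F rk A S" "finite S'" "\<And>X. X \<in> F \<Longrightarrow> S' \<inter> X \<noteq> {}"
  shows "card S \<le> card S'"
proof -
  from assms(1) obtain f where f: "\<And>w. w \<in> S \<Longrightarrow> f w \<in> F \<and>
      (\<forall>w'\<in>S. w \<noteq> w' \<longrightarrow> f w \<inter> f w' = {})"
    unfolding greedy_inv_def by metis
  then have "\<forall>w\<in>S. \<exists>y. y \<in> S' \<inter> f w" using assms(3) by blast
  then obtain g where g: "\<And>w. w \<in> S \<Longrightarrow> g w \<in> S' \<inter> f w" by metis
  have "inj_on g S"
    by (rule inj_onI) (metis Int_iff f g disjoint_iff)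
  with g assms(2) show ?thesis by (intro card_inj_on_le[of g]) auto
qed

section \<open>Interiors of temporal paths are connected\<close>

text \<open>Membership in \<open>U\<close>, later one side of a cut without crossing edges, is
  carried edge by edge to the end of the path. Edges leaving \<open>s\<close> are exempt because
  \<open>s\<close> is deleted from the tree.\<close>

lemma tpath_sources_linked:
  assumes "tpath E s lo v x p" "v \<noteq> s"
    and "\<And>a b i. (a, b, i) \<in> set p \<Longrightarrow> a \<noteq> s \<Longrightarrow> a \<in> U \<longleftrightarrow> b \<in> U"
  shows "\<forall>a\<in>src ` set p - {s}. a \<in> U \<longleftrightarrow> v \<in> U"
  using assms
proof (induction rule: tpath.induct)
  case (tpath_snoc v x p w i)
  show ?case
  proof (cases "v = s")
    case True
    with tpath_snoc.hyps(1) have "p = []" by (auto dest: tpath_at_source)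
    with True show ?thesis by simp
  next
    case False
    have "\<forall>a\<in>src ` set p - {s}. a \<in> U \<longleftrightarrow> v \<in> U"
      by (rule tpath_snoc.IH) (use False tpath_snoc.prems in auto)
    moreover have "v \<in> U \<longleftrightarrow> w \<in> U" using False tpath_snoc.prems by auto
    ultimately show ?thesis by auto
  qed
qed simp

lemma tpath_sources:
  "tpath E s lo v x p \<Longrightarrow> src ` set p \<subseteq> insert s (tgt ` set p)"
proof (induction rule: tpath.induct)
  case (tpath_snoc v x p w i)
  then show ?case using tpath_end[OF tpath_snoc.hyps(1)] by auto
qed simp

lemma tpath_targets:
  "tpath E s lo v x p \<Longrightarrow> tgt ` set p \<subseteq> insert v (src ` set p)"
  by (induction rule: tpath.induct) auto

text \<open>The last edge is split off since its target \<open>z\<close> is deleted too. Its source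
  \<open>v\<close> then serves as the reference: each interior vertex lies on the same side of a
  closed cut as \<open>v\<close>, so a nonempty closed part contains \<open>v\<close> and hence
  everything.\<close>

lemma tpath_interior_cut_connected:
  assumes p: "tpath E s lo z x p" and sz: "s \<noteq> z"
    and adj: "\<And>a b i. (a, b, i) \<in> E \<Longrightarrow> a \<notin> {s, z} \<Longrightarrow> b \<notin> {s, z} \<Longrightarrow> adj a b"
  shows "cut_connected adj (src ` set p - {s})" "z \<notin> src ` set p"
proof -
  from p sz obtain v y q i where q: "p = q @ [(v, z, i)]" "tpath E s lo v y q"
    "(v, z, i) \<in> E" "z \<notin> insert s (tgt ` set q)"
    by (cases rule: tpath.cases) auto
  show zp: "z \<notin> src ` set p"
    using q tpath_sources[OF q(2)] tpath_end[OF q(2)] by auto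
  show "cut_connected adj (src ` set p - {s})"
  proof (cases "v = s")
    case True
    with q(2) have "q = []" by (auto dest: tpath_at_source)
    with True q show ?thesis by (auto simp: cut_connected_def)
  next
    case False
    show ?thesis unfolding cut_connected_def
    proof (intro allI impI)
      fix U
      let ?X = "src ` set p - {s}"
      assume U: "U \<subseteq> ?X \<and> U \<noteq> {} \<and> (\<forall>a\<in>?X. \<forall>b\<in>?X. adj a b \<longrightarrow> (a \<in> U \<longleftrightarrow> b \<in> U))"
      have s_notin: "s \<notin> tgt ` set q"
        using q(2) by (induction rule: tpath.induct) auto
      have "\<forall>a\<in>src ` set q - {s}. a \<in> U \<longleftrightarrow> v \<in> U"
      proof (rule tpath_sources_linked[OF q(2) False])
        fix a b i assume ab: "(a, b, i) \<in> set q" "a \<noteq> s"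
        have b: "b \<in> tgt ` set q" using ab by force
        have a: "a \<in> src ` set p" using ab q(1) by force
        have "b \<in> src ` set p" using b tpath_targets[OF q(2)] q(1) by auto
        moreover have "b \<noteq> s" "b \<noteq> z" using b s_notin q(4) by auto
        moreover have "a \<noteq> z" using a zp by auto
        ultimately have "adj a b" "a \<in> ?X" "b \<in> ?X"
          using ab a tpath_edges[OF q(2)] adj[of a b i] by auto
        with U show "a \<in> U \<longleftrightarrow> b \<in> U" by blast
      qed
      then have *: "a \<in> U \<longleftrightarrow> v \<in> U" if "a \<in> ?X" for a using q(1) that by auto
      from U have sub: "U \<subseteq> ?X" and "U \<noteq> {}" by blast+
      then have "v \<in> U" using * by blast
      with * sub show "U = ?X" by blast
    qed
  qed
qed


section \<open>Program logic with running times\<close>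

text \<open>Total correctness with an upper bound on the steps instead of their exact number, so
  that both branches of a conditional can share one bound.\<close>

definition runs :: "com \<Rightarrow> state \<Rightarrow> nat \<Rightarrow> (state \<Rightarrow> bool) \<Rightarrow> bool" where
  "runs c \<sigma> N Q \<longleftrightarrow> (\<exists>n \<sigma>'. exec c \<sigma> n \<sigma>' \<and> n \<le> N \<and> Q \<sigma>')"

primrec writes :: "com \<Rightarrow> nat set" where
  "writes Skip = {}"
| "writes (Put a i e) = {a}"
| "writes (Seq c d) = writes c \<union> writes d"
| "writes (Cond b c d) = writes c \<union> writes d"
| "writes (Loop b c) = writes c"

text \<open>Frames consist of whole arrays: which array is written is visible in the program text,
  while the cell is known only at run time.\<close>

definition agree_off :: "nat set \<Rightarrow> state \<Rightarrow> state \<Rightarrow> bool" where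
  "agree_off W \<sigma> \<sigma>' \<longleftrightarrow> (\<forall>a. a \<notin> W \<longrightarrow> \<sigma>' a = \<sigma> a)"

lemma exec_agree_off: "exec c \<sigma> n \<sigma>' \<Longrightarrow> agree_off (writes c) \<sigma> \<sigma>'"
  unfolding agree_off_def by (induction rule: exec.induct) auto

lemma runs_frame: "runs c \<sigma> N Q \<Longrightarrow> runs c \<sigma> N (\<lambda>\<sigma>'. Q \<sigma>' \<and> agree_off (writes c) \<sigma> \<sigma>')"
  unfolding runs_def using exec_agree_off by blast

lemma runs_weaken: "runs c \<sigma> N Q \<Longrightarrow> N \<le> N' \<Longrightarrow> (\<And>\<sigma>'. Q \<sigma>' \<Longrightarrow> Q' \<sigma>') \<Longrightarrow> runs c \<sigma> N' Q'"
  unfolding runs_def by (meson order_trans)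

lemma runs_weaken_frame:
  "runs c \<sigma> N Q \<Longrightarrow> N \<le> N' \<Longrightarrow> (\<And>\<sigma>'. Q \<sigma>' \<Longrightarrow> agree_off (writes c) \<sigma> \<sigma>' \<Longrightarrow> Q' \<sigma>')
    \<Longrightarrow> runs c \<sigma> N' Q'"
  by (rule runs_weaken[OF runs_frame]) auto

lemma runs_Skip: "Q \<sigma> \<Longrightarrow> 1 \<le> N \<Longrightarrow> runs Skip \<sigma> N Q"
  unfolding runs_def using exec.Skip by blast

lemma runs_Put: "Q (\<sigma>(a := (\<sigma> a)(aval i \<sigma> := aval e \<sigma>))) \<Longrightarrow> 1 \<le> N \<Longrightarrow> runs (Put a i e) \<sigma> N Q"
  unfolding runs_def using exec.Put by blast

lemma runs_Seq:
  assumes "runs c \<sigma> M (\<lambda>\<sigma>'. runs d \<sigma>' N Q)" "M + N \<le> K"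
  shows "runs (Seq c d) \<sigma> K Q"
proof -
  from assms obtain m \<sigma>' n \<sigma>'' where "exec c \<sigma> m \<sigma>'" "m \<le> M" "exec d \<sigma>' n \<sigma>''" "n \<le> N" "Q \<sigma>''"
    unfolding runs_def by blast
  moreover from this assms(2) have "m + n \<le> K" by linarith
  ultimately show ?thesis unfolding runs_def using exec.Seq by blast
qed

lemma runs_Cond:
  assumes "bval b \<sigma> \<Longrightarrow> runs c \<sigma> N Q" "\<not> bval b \<sigma> \<Longrightarrow> runs d \<sigma> N Q" "N + 1 \<le> K"
  shows "runs (Cond b c d) \<sigma> K Q"
proof (cases "bval b \<sigma>")
  case True
  with assms obtain n \<sigma>' where *: "exec c \<sigma> n \<sigma>'" "n \<le> N" "Q \<sigma>'" unfolding runs_def by blast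
  from exec.CondTrue[OF True *(1)] * assms(3) show ?thesis
    unfolding runs_def by (metis add_le_mono1 order_trans)
next
  case False
  with assms obtain n \<sigma>' where *: "exec d \<sigma> n \<sigma>'" "n \<le> N" "Q \<sigma>'" unfolding runs_def by blast
  from exec.CondFalse[OF False *(1)] * assms(3) show ?thesis
    unfolding runs_def by (metis add_le_mono1 order_trans)
qed

definition For :: "nat \<Rightarrow> aexp \<Rightarrow> com \<Rightarrow> com" where
  "For i e body = Seq (Put i (Const 0) (Const 0))
     (Loop (Lt (Get i (Const 0)) e)
       (Seq body (Put i (Const 0) (Add (Get i (Const 0)) (Const 1)))))"

lemma writes_For [simp]: "writes (For i e body) = insert i (writes body)"
  by (auto simp: For_def)

text \<open>Each iteration costs \<open>N\<close> for the body, one step for the increment and one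
  for the test; the additional 2 are the initialisation and the last, failing test.
  \<open>indep\<close> keeps the counter out of the invariant; its value is passed to
  \<open>body\<close> separately. \<open>L\<close> may exceed the true count \<open>M\<close>, which
  makes all bounds functions of one parameter.\<close>

lemma runs_For:
  assumes I0: "I 0 \<sigma>"
    and body: "\<And>k \<sigma>'. k < M \<Longrightarrow> \<sigma>' i 0 = k \<Longrightarrow> agree_off (insert i (writes body)) \<sigma> \<sigma>'
      \<Longrightarrow> I k \<sigma>' \<Longrightarrow> runs body \<sigma>' N (I (Suc k))"
    and indep: "\<And>k \<sigma>' v. I k \<sigma>' \<Longrightarrow> I k (\<sigma>'(i := v))"
    and bound: "\<And>\<sigma>'. agree_off (insert i (writes body)) \<sigma> \<sigma>' \<Longrightarrow> aval e \<sigma>' = M"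
    and i: "i \<notin> writes body"
    and K: "M \<le> L" "L * (N + 2) + 2 \<le> K"
  shows "runs (For i e body) \<sigma> K (I M)"
proof -
  let ?loop = "Loop (Lt (Get i (Const 0)) e)
       (Seq body (Put i (Const 0) (Add (Get i (Const 0)) (Const 1))))"
  have loop: "\<exists>n \<sigma>''. exec ?loop \<sigma>' n \<sigma>'' \<and> n \<le> (M - k) * (N + 2) + 1 \<and> I M \<sigma>''"
    if "k \<le> M" "\<sigma>' i 0 = k" "agree_off (insert i (writes body)) \<sigma> \<sigma>'" "I k \<sigma>'" for k \<sigma>'
    using that
  proof (induction "M - k" arbitrary: k \<sigma>')
    case 0
    then have b: "\<not> bval (Lt (Get i (Const 0)) e) \<sigma>'" and k: "k = M" using bound by auto
    show ?case using exec.LoopFalse[OF b] 0(5) k by (intro exI conjI) auto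
  next
    case (Suc d)
    then have lt: "k < M" by simp
    then have b: "bval (Lt (Get i (Const 0)) e) \<sigma>'" using bound Suc.prems by auto
    from body[OF lt Suc.prems(2,3,4)] obtain n \<sigma>1 where
      e1: "exec body \<sigma>' n \<sigma>1" "n \<le> N" "I (Suc k) \<sigma>1" unfolding runs_def by blast
    from exec_agree_off[OF e1(1)] have a1: "agree_off (writes body) \<sigma>' \<sigma>1" .
    then have i1: "\<sigma>1 i 0 = k" using i Suc.prems by (simp add: agree_off_def)
    let ?\<sigma>2 = "\<sigma>1(i := (\<sigma>1 i)(0 := Suc k))"
    have "exec (Put i (Const 0) (Add (Get i (Const 0)) (Const 1))) \<sigma>1 1 ?\<sigma>2"
      using exec.Put[of i "Const 0" "Add (Get i (Const 0)) (Const 1)" \<sigma>1] i1 by simp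
    with e1 have e2: "exec (Seq body (Put i (Const 0) (Add (Get i (Const 0)) (Const 1)))) \<sigma>' (n + 1) ?\<sigma>2"
      by (intro exec.Seq)
    have "\<exists>n \<sigma>''. exec ?loop ?\<sigma>2 n \<sigma>'' \<and> n \<le> (M - Suc k) * (N + 2) + 1 \<and> I M \<sigma>''"
      by (rule Suc.hyps(1)) (use Suc e1 a1 lt indep in \<open>auto simp: agree_off_def\<close>)
    then obtain n' \<sigma>'' where e3: "exec ?loop ?\<sigma>2 n' \<sigma>''" "n' \<le> (M - Suc k) * (N + 2) + 1" "I M \<sigma>''"
      by blast
    from exec.LoopTrue[OF b e2 e3(1)] have "exec ?loop \<sigma>' (n + 1 + n' + 1) \<sigma>''" .
    moreover have "n + 1 + n' + 1 \<le> (M - k) * (N + 2) + 1"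
    proof -
      have "M - k = Suc (M - Suc k)" using lt by simp
      then show ?thesis using e1(2) e3(2) by simp
    qed
    ultimately show ?case using e3(3) by blast
  qed
  let ?\<sigma>0 = "\<sigma>(i := (\<sigma> i)(0 := 0))"
  have "\<exists>n \<sigma>''. exec ?loop ?\<sigma>0 n \<sigma>'' \<and> n \<le> (M - 0) * (N + 2) + 1 \<and> I M \<sigma>''"
    by (rule loop) (use I0 indep in \<open>auto simp: agree_off_def\<close>)
  then obtain n \<sigma>'' where e: "exec ?loop ?\<sigma>0 n \<sigma>''" "n \<le> M * (N + 2) + 1" "I M \<sigma>''" by auto
  have "exec (Put i (Const 0) (Const 0)) \<sigma> 1 ?\<sigma>0"
    using exec.Put[of i "Const 0" "Const 0" \<sigma>] by simp
  from exec.Seq[OF this e(1)] have "exec (For i e body) \<sigma> (1 + n) \<sigma>''" unfolding For_def .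
  moreover have "M * (N + 2) \<le> L * (N + 2)" using K(1) by (rule mult_right_mono) simp
  then have "1 + n \<le> K" using e(2) K(2) by linarith
  ultimately show ?thesis using e(3) unfolding runs_def by blast
qed


section \<open>The reachability test\<close>

abbreviation var :: "nat \<Rightarrow> aexp" where "var a \<equiv> Get a (Const 0)"
abbreviation input :: "nat \<Rightarrow> aexp" where "input k \<equiv> Get 0 (Const k)"

definition vertex_at :: "aexp \<Rightarrow> aexp" where
  "vertex_at i = Get 0 (Add (Const 6) i)"

text \<open>Six header cells and the vertex list, whose length is in cell 4, precede the edge
  triples. The index is tripled by additions, as the machine does not multiply.\<close>

definition edge_field :: "nat \<Rightarrow> aexp \<Rightarrow> aexp" where
  "edge_field j k = Get 0 (Add (Add (Const (6 + j)) (input 4)) (Add (Add k k) k))"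

abbreviation "src_at \<equiv> edge_field 0"
abbreviation "tgt_at \<equiv> edge_field 1"
abbreviation "label_at \<equiv> edge_field 2"

text \<open>
  Array 2 marks the vertices that may be used, array 3 holds earliest arrival times for a given
  starting time, array 4 the verdict, and arrays 5 to 8 the loop counters.
\<close>

definition relax_prog :: com where
  "relax_prog =
     Cond (Conj (Lt (Const 0) (Get 2 (src_at (var 8))))
            (Conj (Neg (Lt (label_at (var 8)) (Get 3 (src_at (var 8)))))
                  (Lt (label_at (var 8)) (Get 3 (tgt_at (var 8))))))
       (Put 3 (tgt_at (var 8)) (label_at (var 8)))
       Skip"

text \<open>All cells start at the deadline, the label plus \<open>t\<close>: an arrival from then
  on is too late, so within this window the deadline acts as infinity. The number of edges bounds
  the length of any path and hence the number of rounds.\<close>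

definition window_prog :: com where
  "window_prog =
     Seq (For 6 (input 4) (Put 3 (vertex_at (var 6)) (Add (label_at (var 5)) (input 3))))
       (Seq (Put 3 (input 1) (label_at (var 5)))
         (Seq (For 7 (input 5) (For 8 (input 5) relax_prog))
           (Cond (Lt (Get 3 (input 2)) (Add (label_at (var 5)) (input 3)))
             (Put 4 (Const 0) (Const 1))
             Skip)))"

definition reach_prog :: com where
  "reach_prog = Seq (Put 4 (Const 0) (Const 0)) (For 5 (input 5) window_prog)"

lemma writes_relax_prog [simp]: "writes relax_prog = {3}"
  by (simp add: relax_prog_def)
lemma writes_window_prog [simp]: "writes window_prog = {3, 4, 6, 7, 8}"
  by (auto simp: window_prog_def)
lemma writes_reach_prog [simp]: "writes reach_prog = {3, 4, 5, 6, 7, 8}"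
  by (auto simp: reach_prog_def)

text \<open>Left unsimplified: the terms mirror the nesting of sequences and loops, so the bounds
  required by the sequence rule hold by reflexivity.\<close>

definition window_time :: "nat \<Rightarrow> nat" where
  "window_time L = (L * (1 + 2) + 2) + (1 + ((L * ((L * (2 + 2) + 2) + 2) + 2) + 2))"

definition reach_time :: "nat \<Rightarrow> nat" where
  "reach_time L = 1 + (L * (window_time L + 2) + 2)"

section \<open>Invariants of the earliest-arrival computation\<close>

text \<open>Values from \<open>hi\<close> on claim nothing. The witness may arrive strictly before
  \<open>d v\<close>, because after a relaxation it can be a path that was cut short.\<close>

definition arrivals_sound ::
    "'a tedge set \<Rightarrow> 'a \<Rightarrow> nat \<Rightarrow> nat \<Rightarrow> 'a set \<Rightarrow> 'a set \<Rightarrow> ('a \<Rightarrow> nat) \<Rightarrow> bool" where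
  "arrivals_sound E s lo hi A V d \<longleftrightarrow> (\<forall>v\<in>V. d v < hi \<longrightarrow>
     (\<exists>p x. tpath E s lo v x p \<and> x \<le> d v \<and> src ` set p \<subseteq> A))"

definition arrivals_complete ::
    "'a tedge set \<Rightarrow> 'a \<Rightarrow> nat \<Rightarrow> 'a set \<Rightarrow> nat \<Rightarrow> ('a \<Rightarrow> nat) \<Rightarrow> bool" where
  "arrivals_complete E s lo A r d \<longleftrightarrow>
     (\<forall>v x p. tpath E s lo v x p \<and> length p \<le> r \<and> src ` set p \<subseteq> A \<longrightarrow> d v \<le> x)"

text \<open>The path to \<open>u\<close> is extended by the edge unless it visits \<open>w\<close>
  already; in that case its prefix up to \<open>w\<close> is the witness, arriving no later than at
  \<open>u\<close>.\<close>

lemma arrivals_sound_relax: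
  assumes "arrivals_sound E s lo hi A V d" "(u, w, i) \<in> E" "u \<in> A" "u \<in> V" "d u \<le> i"
  shows "arrivals_sound E s lo hi A V (d(w := i))"
  unfolding arrivals_sound_def
proof (intro ballI impI)
  fix v assume v: "v \<in> V" "(d(w := i)) v < hi"
  show "\<exists>p x. tpath E s lo v x p \<and> x \<le> (d(w := i)) v \<and> src ` set p \<subseteq> A"
  proof (cases "v = w")
    case False
    with v assms(1) show ?thesis by (simp add: arrivals_sound_def)
  next
    case True
    with v assms(5) have "d u < hi" by simp
    with assms(1,4) obtain p x where p: "tpath E s lo u x p" "x \<le> d u" "src ` set p \<subseteq> A"
      unfolding arrivals_sound_def by blast
    show ?thesis
    proof (cases "w \<in> insert s (tgt ` set p)")
      case inside: True
      from tpath_prefix[OF p(1) inside] obtain p' x' where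
        p': "tpath E s lo w x' p'" "x' \<le> x" "set p' \<subseteq> set p" by blast
      have "src ` set p' \<subseteq> A" using p'(3) p(3) by blast
      with p' p(2) True assms(5) show ?thesis by (intro exI[of _ p'] exI[of _ x']) auto
    next
      case False
      from tpath_snoc[OF p(1) assms(2) _ False] p(2,3) True assms(3,5) show ?thesis
        by (intro exI[of _ "p @ [(u, w, i)]"] exI[of _ i]) auto
    qed
  qed
qed

text \<open>The edges are relaxed in place, but \<open>relaxed\<close> refers to the values
  \<open>d\<close> from before the round. As values only fall, in-place updates can only
  help.\<close>

lemma arrivals_complete_round:
  assumes c: "arrivals_complete E s lo A r d" and le: "\<And>v. d' v \<le> d v"
    and relaxed: "\<And>u w i. (u, w, i) \<in> E \<Longrightarrow> u \<in> A \<Longrightarrow> d u \<le> i \<Longrightarrow> d' w \<le> i"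
  shows "arrivals_complete E s lo A (Suc r) d'"
  unfolding arrivals_complete_def
proof (intro allI impI)
  fix v x p assume p: "tpath E s lo v x p \<and> length p \<le> Suc r \<and> src ` set p \<subseteq> A"
  then have tp: "tpath E s lo v x p" by simp
  then show "d' v \<le> x"
  proof (cases rule: tpath.cases)
    case tpath_Nil
    with c tp have "d v \<le> x" unfolding arrivals_complete_def
      by (metis empty_subsetI image_empty le0 list.set(1) list.size(3))
    with le[of v] show ?thesis by simp
  next
    case (tpath_snoc u y q)
    with p have "length q \<le> r" "src ` set q \<subseteq> A" "u \<in> A" by auto
    with tpath_snoc(2) c have "d u \<le> y" unfolding arrivals_complete_def by blast
    with tpath_snoc \<open>u \<in> A\<close> show ?thesis by (intro relaxed[of u v x]) auto
  qed
qed

lemma nth_concat_triples: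
  "k < length es \<Longrightarrow> j < 3 \<Longrightarrow>
     concat (map (\<lambda>(u, v, i). [u, v, i]) es) ! (j + (k + k + k)) =
     (if j = 0 then src (es ! k) else if j = 1 then tgt (es ! k) else label (es ! k))"
proof (induction es arbitrary: k)
  case (Cons e es)
  obtain u v i where e: "e = (u, v, i)" by (cases e) auto
  show ?case
  proof (cases k)
    case 0
    have "j = 0 \<or> j = 1 \<or> j = 2" using Cons.prems by auto
    with 0 e show ?thesis by auto
  next
    case (Suc k')
    with Cons have "concat (map (\<lambda>(u, v, i). [u, v, i]) es) ! (j + (k' + k' + k')) =
     (if j = 0 then src (es ! k') else if j = 1 then tgt (es ! k') else label (es ! k'))" by simp
    moreover have "j + (k + k + k) = Suc (Suc (Suc (j + (k' + k' + k'))))" using Suc by simp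
    ultimately show ?thesis using e Suc by simp
  qed
qed simp

section \<open>The reachability program on an encoded instance\<close>

locale separator_input =
  fixes G :: "nat tgraph" and s z t :: nat and vs :: "nat list" and es :: "nat tedge list"
  assumes G: "temporal_graph G" and s: "s \<in> tverts G" and z: "z \<in> tverts G" and sz: "s \<noteq> z"
    and vs: "distinct vs" "set vs = tverts G" and es: "distinct es" "set es = tedges G"
begin

definition code :: "nat list" where
  "code = [lifetime G, s, z, t, length vs, length es] @ vs @
     concat (map (\<lambda>(u, v, i). [u, v, i]) es)"

definition has_input :: "state \<Rightarrow> bool" where
  "has_input \<sigma> \<longleftrightarrow> \<sigma> 0 = load code 0"

lemma length_code: "length code = 6 + length vs + 3 * length es"
proof -
  have "length (concat (map (\<lambda>(u, v, i). [u, v, i]) es)) = 3 * length es"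
    by (induction es) auto
  then show ?thesis by (simp add: code_def)
qed

lemma has_input_agree: "has_input \<sigma> \<Longrightarrow> agree_off W \<sigma> \<sigma>' \<Longrightarrow> 0 \<notin> W \<Longrightarrow> has_input \<sigma>'"
  by (simp add: has_input_def agree_off_def)

lemma has_input_upd [simp]: "a \<noteq> 0 \<Longrightarrow> has_input (\<sigma>(a := f)) \<longleftrightarrow> has_input \<sigma>"
  by (simp add: has_input_def)

lemma input_header:
  assumes "has_input \<sigma>"
  shows "\<sigma> 0 (Suc 0) = s" "\<sigma> 0 2 = z" "\<sigma> 0 3 = t" "\<sigma> 0 4 = length vs" "\<sigma> 0 5 = length es"
  using assms by (simp_all add: has_input_def load_def length_code) (simp_all add: code_def)

lemma aval_vertex_at:
  assumes "has_input \<sigma>" "aval i \<sigma> < length vs"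
  shows "aval (vertex_at i) \<sigma> = vs ! aval i \<sigma>"
  using assms
  by (simp add: vertex_at_def has_input_def load_def length_code) (simp add: code_def nth_append)

lemma aval_edge_field:
  assumes \<sigma>: "has_input \<sigma>" and k: "aval k \<sigma> < length es" and j: "j < 3"
  shows "aval (edge_field j k) \<sigma> = (if j = 0 then src (es ! aval k \<sigma>)
    else if j = 1 then tgt (es ! aval k \<sigma>) else label (es ! aval k \<sigma>))"
proof -
  let ?i = "j + (aval k \<sigma> + aval k \<sigma> + aval k \<sigma>)"
  have code: "code ! (6 + length vs + i) = concat (map (\<lambda>(u, v, i). [u, v, i]) es) ! i" for i
    by (simp add: code_def nth_append)
  have "aval (edge_field j k) \<sigma> = \<sigma> 0 (6 + length vs + ?i)"
    using input_header[OF \<sigma>] by (simp add: edge_field_def algebra_simps)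
  also have "\<dots> = code ! (6 + length vs + ?i)"
    using \<sigma> k j by (simp add: has_input_def load_def length_code)
  also have "\<dots> = concat (map (\<lambda>(u, v, i). [u, v, i]) es) ! ?i"
    by (rule code)
  finally show ?thesis using nth_concat_triples[OF k j] by simp
qed

lemmas aval_edge = aval_edge_field[where j = 0, simplified] aval_edge_field[where j = 1, simplified]
  aval_edge_field[where j = 2, simplified]

lemma edge_in: "k < length es \<Longrightarrow> (src (es ! k), tgt (es ! k), label (es ! k)) \<in> tedges G"
  using es by (simp add: tedge_collapse flip: es(2))

lemma edge_verts: "(u, v, i) \<in> tedges G \<Longrightarrow> u \<in> tverts G \<and> v \<in> tverts G"
  using G unfolding temporal_graph_def by blast

lemma edge_index: "(u, v, i) \<in> tedges G \<Longrightarrow>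
    \<exists>k<length es. src (es ! k) = u \<and> tgt (es ! k) = v \<and> label (es ! k) = i"
  using es(2) by (metis in_set_conv_nth tedge_sels)

lemma runs_relax_prog:
  assumes \<sigma>: "has_input \<sigma>" and k: "\<sigma> 8 0 = k" "k < length es"
  shows "runs relax_prog \<sigma> 2 (\<lambda>\<sigma>'. \<sigma>' 3 =
    (let u = src (es ! k); w = tgt (es ! k); i = label (es ! k)
     in if 0 < \<sigma> 2 u \<and> \<sigma> 3 u \<le> i \<and> i < \<sigma> 3 w then (\<sigma> 3)(w := i) else \<sigma> 3))"
  unfolding relax_prog_def
  by (rule runs_Cond[where N = 1]; (rule runs_Put runs_Skip)?)
    (use k in \<open>auto simp: Let_def aval_edge[OF \<sigma>]\<close>)

lemma runs_round:
  assumes \<sigma>: "has_input \<sigma>" and L: "length es \<le> L"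
    and sound: "arrivals_sound (tedges G) s lo hi {v. 0 < \<sigma> 2 v} (tverts G) (\<sigma> 3)"
    and complete: "arrivals_complete (tedges G) s lo {v. 0 < \<sigma> 2 v} r (\<sigma> 3)"
  shows "runs (For 8 (input 5) relax_prog) \<sigma> (L * (2 + 2) + 2) (\<lambda>\<sigma>'.
    arrivals_sound (tedges G) s lo hi {v. 0 < \<sigma> 2 v} (tverts G) (\<sigma>' 3) \<and>
    arrivals_complete (tedges G) s lo {v. 0 < \<sigma> 2 v} (Suc r) (\<sigma>' 3))"
proof -
  let ?A = "{v. 0 < \<sigma> 2 v}"
  \<comment> \<open>The last conjunct compares with \<open>\<sigma> 3\<close>, the arrivals before
    the round, as \<open>arrivals_complete_round\<close> demands. By the middle conjunct the current
    arrival at a source is no larger, so the test in the program still succeeds unless the target is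
    early enough already.\<close>
  define I where "I k \<sigma>' \<longleftrightarrow> arrivals_sound (tedges G) s lo hi ?A (tverts G) (\<sigma>' 3) \<and>
      (\<forall>v. \<sigma>' 3 v \<le> \<sigma> 3 v) \<and>
      (\<forall>j<k. src (es ! j) \<in> ?A \<and> \<sigma> 3 (src (es ! j)) \<le> label (es ! j) \<longrightarrow>
         \<sigma>' 3 (tgt (es ! j)) \<le> label (es ! j))" for k and \<sigma>' :: state
  have "runs (For 8 (input 5) relax_prog) \<sigma> (L * (2 + 2) + 2) (I (length es))"
  proof (rule runs_For[where N = 2, OF _ _ _ _ _ L])
    show "I 0 \<sigma>" using sound by (simp add: I_def)
  next
    fix k \<sigma>' assume k: "k < length es" "\<sigma>' 8 0 = k"
      and agree: "agree_off (insert 8 (writes relax_prog)) \<sigma> \<sigma>'" and I: "I k \<sigma>'"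
    have \<sigma>': "has_input \<sigma>'" by (rule has_input_agree[OF \<sigma> agree]) simp
    have A: "\<sigma>' 2 = \<sigma> 2" using agree by (simp add: agree_off_def)
    let ?u = "src (es ! k)" and ?w = "tgt (es ! k)" and ?i = "label (es ! k)"
    show "runs relax_prog \<sigma>' 2 (I (Suc k))"
    proof (rule runs_weaken[OF runs_relax_prog[OF \<sigma>' k(2,1)] order.refl])
      fix \<sigma>'' :: state assume *: "\<sigma>'' 3 = (let u = ?u; w = ?w; i = ?i
         in if 0 < \<sigma>' 2 u \<and> \<sigma>' 3 u \<le> i \<and> i < \<sigma>' 3 w then (\<sigma>' 3)(w := i) else \<sigma>' 3)"
      have le: "\<sigma>'' 3 v \<le> \<sigma>' 3 v" for v using * by (simp add: Let_def)
      have "arrivals_sound (tedges G) s lo hi ?A (tverts G) (\<sigma>'' 3)"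
        using I arrivals_sound_relax[OF _ edge_in[OF k(1)], of s lo hi ?A "tverts G" "\<sigma>' 3"]
          edge_verts[OF edge_in[OF k(1)]] * A
        by (auto simp: Let_def I_def)
      moreover have "\<sigma>'' 3 (tgt (es ! j)) \<le> label (es ! j)"
        if j: "j < Suc k" "src (es ! j) \<in> ?A" "\<sigma> 3 (src (es ! j)) \<le> label (es ! j)" for j
      proof (cases "j = k")
        case False
        with j I have "\<sigma>' 3 (tgt (es ! j)) \<le> label (es ! j)" by (simp add: I_def)
        with le show ?thesis by (rule order_trans)
      next
        case True
        moreover have "\<sigma>' 3 (src (es ! j)) \<le> label (es ! j)"
          using I j(3) order_trans unfolding I_def by blast
        ultimately show ?thesis using * A j by (auto simp: Let_def)
      qed
      moreover have "\<sigma>'' 3 v \<le> \<sigma> 3 v" for v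
        using le I order_trans unfolding I_def by blast
      ultimately show "I (Suc k) \<sigma>''" unfolding I_def by blast
    qed
  next
    fix \<sigma>' assume agree: "agree_off (insert 8 (writes relax_prog)) \<sigma> \<sigma>'"
    have "has_input \<sigma>'" by (rule has_input_agree[OF \<sigma> agree]) simp
    then show "aval (input 5) \<sigma>' = length es" by (simp add: input_header)
  qed (simp_all add: I_def)
  then show ?thesis
  proof (rule runs_weaken)
    fix \<sigma>' assume I: "I (length es) \<sigma>'"
    have "arrivals_complete (tedges G) s lo ?A (Suc r) (\<sigma>' 3)"
    proof (rule arrivals_complete_round[OF complete])
      fix u w i assume "(u, w, i) \<in> tedges G" "u \<in> ?A" "\<sigma> 3 u \<le> i"
      with edge_index[of u w i] I show "\<sigma>' 3 w \<le> i" by (auto simp: I_def)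
    qed (use I in \<open>simp add: I_def\<close>)
    with I show "arrivals_sound (tedges G) s lo hi ?A (tverts G) (\<sigma>' 3) \<and>
      arrivals_complete (tedges G) s lo ?A (Suc r) (\<sigma>' 3)" by (simp add: I_def)
  qed simp
qed

lemma runs_rounds:
  assumes \<sigma>: "has_input \<sigma>" and L: "length es \<le> L"
    and sound: "arrivals_sound (tedges G) s lo hi {v. 0 < \<sigma> 2 v} (tverts G) (\<sigma> 3)"
    and complete: "arrivals_complete (tedges G) s lo {v. 0 < \<sigma> 2 v} 0 (\<sigma> 3)"
  shows "runs (For 7 (input 5) (For 8 (input 5) relax_prog)) \<sigma>
    (L * ((L * (2 + 2) + 2) + 2) + 2) (\<lambda>\<sigma>'.
    arrivals_sound (tedges G) s lo hi {v. 0 < \<sigma> 2 v} (tverts G) (\<sigma>' 3) \<and>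
    arrivals_complete (tedges G) s lo {v. 0 < \<sigma> 2 v} (length es) (\<sigma>' 3))"
proof (rule runs_For[where N = "L * (2 + 2) + 2", OF _ _ _ _ _ L, where I = "\<lambda>r \<sigma>'.
    arrivals_sound (tedges G) s lo hi {v. 0 < \<sigma> 2 v} (tverts G) (\<sigma>' 3) \<and>
    arrivals_complete (tedges G) s lo {v. 0 < \<sigma> 2 v} r (\<sigma>' 3)"])
  fix k \<sigma>'
  assume agree: "agree_off (insert 7 (writes (For 8 (input 5) relax_prog))) \<sigma> \<sigma>'"
    and I: "arrivals_sound (tedges G) s lo hi {v. 0 < \<sigma> 2 v} (tverts G) (\<sigma>' 3) \<and>
    arrivals_complete (tedges G) s lo {v. 0 < \<sigma> 2 v} k (\<sigma>' 3)"
  have \<sigma>': "has_input \<sigma>'" by (rule has_input_agree[OF \<sigma> agree]) simp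
  have A: "\<sigma>' 2 = \<sigma> 2" using agree by (simp add: agree_off_def)
  from runs_round[OF \<sigma>' L, of lo hi k] I
  show "runs (For 8 (input 5) relax_prog) \<sigma>' (L * (2 + 2) + 2) (\<lambda>\<sigma>'.
    arrivals_sound (tedges G) s lo hi {v. 0 < \<sigma> 2 v} (tverts G) (\<sigma>' 3) \<and>
    arrivals_complete (tedges G) s lo {v. 0 < \<sigma> 2 v} (Suc k) (\<sigma>' 3))"
    unfolding A by blast
next
  fix \<sigma>' assume agree: "agree_off (insert 7 (writes (For 8 (input 5) relax_prog))) \<sigma> \<sigma>'"
  have "has_input \<sigma>'" by (rule has_input_agree[OF \<sigma> agree]) simp
  then show "aval (input 5) \<sigma>' = length es" by (simp add: input_header)
qed (use sound complete in simp_all)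

definition reaches_from :: "nat set \<Rightarrow> nat \<Rightarrow> bool" where
  "reaches_from A lo \<longleftrightarrow> (\<exists>x p. tpath (tedges G) s lo z x p \<and> x < lo + t \<and> src ` set p \<subseteq> A)"

text \<open>Postponing the start to the label of the first edge only moves the deadline
  later.\<close>

lemma reaches_iff_reaches_from:
  "reaches (tedges G) s z t A \<longleftrightarrow> (\<exists>k<length es. reaches_from A (label (es ! k)))"
proof
  assume "reaches (tedges G) s z t A"
  then obtain lo x p where p: "tpath (tedges G) s lo z x p" "x < lo + t" "src ` set p \<subseteq> A"
    unfolding reaches_def by blast
  then have ne: "p \<noteq> []" using sz by (auto simp: tpath_Nil_iff)
  have "hd p \<in> set es" using tpath_edges[OF p(1)] ne es(2) hd_in_set by blast
  then obtain k where "k < length es" "es ! k = hd p" by (auto simp: in_set_conv_nth)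
  with p tpath_restart[OF p(1) ne] show "\<exists>k<length es. reaches_from A (label (es ! k))"
    unfolding reaches_from_def
    by (intro exI[of _ k] conjI exI[of _ x] exI[of _ p]) auto
qed (auto simp: reaches_def reaches_from_def)

text \<open>An arrival before the deadline is certified by soundness; conversely a path within the
  window is short enough to be covered by completeness.\<close>

lemma arrival_window_correct:
  assumes "arrivals_sound (tedges G) s lo (lo + t) A (tverts G) d"
    "arrivals_complete (tedges G) s lo A (length es) d"
  shows "d z < lo + t \<longleftrightarrow> reaches_from A lo"
proof
  assume "d z < lo + t"
  with assms(1) z obtain p x where "tpath (tedges G) s lo z x p" "x \<le> d z" "src ` set p \<subseteq> A"
    unfolding arrivals_sound_def by blast
  with \<open>d z < lo + t\<close> show "reaches_from A lo"
    unfolding reaches_from_def by (intro exI[of _ x] exI[of _ p]) simp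
next
  assume "reaches_from A lo"
  then obtain x p where p: "tpath (tedges G) s lo z x p" "x < lo + t" "src ` set p \<subseteq> A"
    unfolding reaches_from_def by blast
  \<comment> \<open>A path repeats no edge, so as many rounds as there are edges cover it.\<close>
  have "length p = card (set p)" using tpath_distinct[OF p(1)] by (simp add: distinct_card)
  also have "\<dots> \<le> card (set es)" using tpath_edges[OF p(1)] es(2) by (intro card_mono[OF finite_set]) simp
  also have "\<dots> \<le> length es" by (rule card_length)
  finally have "d z \<le> x" using assms(2) p unfolding arrivals_complete_def by blast
  with p(2) show "d z < lo + t" by simp
qed

text \<open>The verdict cell is raised but never lowered, so that the loop over all edges
  accumulates the disjunction over starting times.\<close>

lemma runs_window_prog:
  assumes \<sigma>: "has_input \<sigma>" and k: "\<sigma> 5 0 = k" "k < length es"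
    and L: "length es \<le> L" "length vs \<le> L" and A: "A = {v. 0 < \<sigma> 2 v}"
  shows "runs window_prog \<sigma> (window_time L)
    (\<lambda>\<sigma>'. \<sigma>' 4 0 = (if reaches_from A (label (es ! k)) then 1 else \<sigma> 4 0))"
proof -
  let ?lo = "label (es ! k)"
  let ?init = "For 6 (input 4) (Put 3 (vertex_at (var 6)) (Add (label_at (var 5)) (input 3)))"
  have init: "runs ?init \<sigma> (L * (1 + 2) + 2) (\<lambda>\<sigma>'. \<forall>j<length vs. \<sigma>' 3 (vs ! j) = ?lo + t)"
  proof (rule runs_For[where N = 1, OF _ _ _ _ _ L(2),
        where I = "\<lambda>i \<sigma>'. \<forall>j<i. \<sigma>' 3 (vs ! j) = ?lo + t"])
    fix i \<sigma>'
    assume i: "i < length vs" "\<sigma>' 6 0 = i" and I: "\<forall>j<i. \<sigma>' 3 (vs ! j) = ?lo + t"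
      and agree: "agree_off (insert 6 (writes
        (Put 3 (vertex_at (var 6)) (Add (label_at (var 5)) (input 3))))) \<sigma> \<sigma>'"
    have \<sigma>': "has_input \<sigma>'" by (rule has_input_agree[OF \<sigma> agree]) simp
    have "\<sigma>' 5 = \<sigma> 5" using agree by (simp add: agree_off_def)
    with i I k show "runs (Put 3 (vertex_at (var 6)) (Add (label_at (var 5)) (input 3))) \<sigma>' 1
        (\<lambda>\<sigma>'. \<forall>j<Suc i. \<sigma>' 3 (vs ! j) = ?lo + t)"
      by (intro runs_Put) (auto simp: aval_edge[OF \<sigma>'] aval_vertex_at[OF \<sigma>'] input_header[OF \<sigma>']
          less_Suc_eq)
  next
    fix \<sigma>' assume agree: "agree_off (insert 6 (writes
        (Put 3 (vertex_at (var 6)) (Add (label_at (var 5)) (input 3))))) \<sigma> \<sigma>'"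
    have "has_input \<sigma>'" by (rule has_input_agree[OF \<sigma> agree]) simp
    then show "aval (input 4) \<sigma>' = length vs" by (simp add: input_header)
  qed simp_all
  show ?thesis
    unfolding window_prog_def window_time_def
  proof (rule runs_Seq[OF runs_weaken_frame[OF init order.refl] order.refl])
    fix \<sigma>1 assume 1: "\<forall>j<length vs. \<sigma>1 3 (vs ! j) = ?lo + t" and agree1: "agree_off (writes ?init) \<sigma> \<sigma>1"
    have in1: "has_input \<sigma>1" by (rule has_input_agree[OF \<sigma> agree1]) simp
    have same1: "\<sigma>1 2 = \<sigma> 2" "\<sigma>1 4 = \<sigma> 4" "\<sigma>1 5 = \<sigma> 5" using agree1 by (simp_all add: agree_off_def)
    define \<sigma>2 where "\<sigma>2 = \<sigma>1(3 := (\<sigma>1 3)(s := ?lo))"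
    have in2: "has_input \<sigma>2" using in1 by (simp add: \<sigma>2_def)
    have vals: "\<sigma>2 3 v = (if v = s then ?lo else ?lo + t)" if "v \<in> tverts G" for v
      using that 1 by (auto simp: \<sigma>2_def in_set_conv_nth simp flip: vs(2))
    have "arrivals_sound (tedges G) s ?lo (?lo + t) {v. 0 < \<sigma>2 2 v} (tverts G) (\<sigma>2 3)"
      unfolding arrivals_sound_def
    proof (intro ballI impI)
      fix v assume v: "v \<in> tverts G" "\<sigma>2 3 v < ?lo + t"
      then have "v = s" using vals[OF v(1)] by (auto split: if_splits)
      with vals[OF v(1)] show "\<exists>p x. tpath (tedges G) s ?lo v x p \<and> x \<le> \<sigma>2 3 v \<and>
          src ` set p \<subseteq> {v. 0 < \<sigma>2 2 v}"
        by (intro exI[of _ "[]"] exI[of _ ?lo]) (simp add: tpath_Nil)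
    qed
    moreover have "arrivals_complete (tedges G) s ?lo {v. 0 < \<sigma>2 2 v} 0 (\<sigma>2 3)"
      using vals[OF s] by (auto simp: arrivals_complete_def tpath_Nil_iff)
    ultimately have rounds: "runs (For 7 (input 5) (For 8 (input 5) relax_prog)) \<sigma>2
        (L * ((L * (2 + 2) + 2) + 2) + 2) (\<lambda>\<sigma>'.
        arrivals_sound (tedges G) s ?lo (?lo + t) {v. 0 < \<sigma>2 2 v} (tverts G) (\<sigma>' 3) \<and>
        arrivals_complete (tedges G) s ?lo {v. 0 < \<sigma>2 2 v} (length es) (\<sigma>' 3))"
      by (rule runs_rounds[OF in2 L(1)])
    have A2: "{v. 0 < \<sigma>2 2 v} = A" using A same1 by (simp add: \<sigma>2_def)
    have upd: "\<sigma>1(3 := (\<sigma>1 3)(aval (input 1) \<sigma>1 := aval (label_at (var 5)) \<sigma>1)) = \<sigma>2"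
      using k same1 by (simp add: \<sigma>2_def input_header[OF in1] aval_edge[OF in1])
    show "runs (Seq (Put 3 (input 1) (label_at (var 5)))
         (Seq (For 7 (input 5) (For 8 (input 5) relax_prog))
           (Cond (Lt (Get 3 (input 2)) (Add (label_at (var 5)) (input 3)))
             (Put 4 (Const 0) (Const 1))
             Skip))) \<sigma>1 (1 + ((L * ((L * (2 + 2) + 2) + 2) + 2) + 2))
         (\<lambda>\<sigma>'. \<sigma>' 4 0 = (if reaches_from A ?lo then 1 else \<sigma> 4 0))"
    proof (rule runs_Seq[OF runs_Put order.refl], unfold upd,
        rule runs_Seq[OF runs_weaken_frame[OF rounds order.refl] order.refl])
      fix \<sigma>3 :: state assume "arrivals_sound (tedges G) s ?lo (?lo + t) {v. 0 < \<sigma>2 2 v} (tverts G) (\<sigma>3 3) \<and>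
        arrivals_complete (tedges G) s ?lo {v. 0 < \<sigma>2 2 v} (length es) (\<sigma>3 3)"
      then have 3: "\<sigma>3 3 z < ?lo + t \<longleftrightarrow> reaches_from A ?lo"
        unfolding A2 by (intro arrival_window_correct) auto
      assume agree3: "agree_off (writes (For 7 (input 5) (For 8 (input 5) relax_prog))) \<sigma>2 \<sigma>3"
      have in3: "has_input \<sigma>3" by (rule has_input_agree[OF in2 agree3]) simp
      have same3: "\<sigma>3 4 = \<sigma> 4" "\<sigma>3 5 = \<sigma> 5"
        using agree3 same1 by (simp_all add: agree_off_def \<sigma>2_def)
      show "runs (Cond (Lt (Get 3 (input 2)) (Add (label_at (var 5)) (input 3)))
             (Put 4 (Const 0) (Const 1)) Skip) \<sigma>3 2
             (\<lambda>\<sigma>'. \<sigma>' 4 0 = (if reaches_from A ?lo then 1 else \<sigma> 4 0))"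
        by (rule runs_Cond[where N = 1]; (rule runs_Put runs_Skip)?)
          (use 3 same3 k in \<open>auto simp: input_header[OF in3] aval_edge[OF in3]\<close>)
    qed simp
  qed
qed

lemma runs_reach_prog:
  assumes \<sigma>: "has_input \<sigma>" and L: "length es \<le> L" "length vs \<le> L"
  shows "runs reach_prog \<sigma> (reach_time L)
    (\<lambda>\<sigma>'. \<sigma>' 4 0 = (if reaches (tedges G) s z t {v. 0 < \<sigma> 2 v} then 1 else 0))"
proof -
  let ?A = "{v. 0 < \<sigma> 2 v}"
  define \<sigma>1 where "\<sigma>1 = \<sigma>(4 := (\<sigma> 4)(0 := 0))"
  have in1: "has_input \<sigma>1" using \<sigma> by (simp add: \<sigma>1_def)
  have "runs (For 5 (input 5) window_prog) \<sigma>1 (L * (window_time L + 2) + 2)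
    (\<lambda>\<sigma>'. \<sigma>' 4 0 = (if \<exists>k<length es. reaches_from ?A (label (es ! k)) then 1 else 0))"
  proof (rule runs_For[where N = "window_time L", OF _ _ _ _ _ L(1), where
        I = "\<lambda>j \<sigma>'. \<sigma>' 4 0 = (if \<exists>k<j. reaches_from ?A (label (es ! k)) then 1 else 0)"])
    fix k \<sigma>'
    assume k: "k < length es" "\<sigma>' 5 0 = k" and agree: "agree_off (insert 5 (writes window_prog)) \<sigma>1 \<sigma>'"
      and I: "\<sigma>' 4 0 = (if \<exists>i<k. reaches_from ?A (label (es ! i)) then 1 else 0)"
    have \<sigma>': "has_input \<sigma>'" by (rule has_input_agree[OF in1 agree]) simp
    have A: "?A = {v. 0 < \<sigma>' 2 v}" using agree by (simp add: agree_off_def \<sigma>1_def)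
    show "runs window_prog \<sigma>' (window_time L)
        (\<lambda>\<sigma>'. \<sigma>' 4 0 = (if \<exists>i<Suc k. reaches_from ?A (label (es ! i)) then 1 else 0))"
      by (rule runs_weaken[OF runs_window_prog[OF \<sigma>' k(2,1) L A] order.refl])
        (use I in \<open>auto simp: less_Suc_eq\<close>)
  next
    fix \<sigma>' assume agree: "agree_off (insert 5 (writes window_prog)) \<sigma>1 \<sigma>'"
    have "has_input \<sigma>'" by (rule has_input_agree[OF in1 agree]) simp
    then show "aval (input 5) \<sigma>' = length es" by (simp add: input_header)
  qed (simp_all add: \<sigma>1_def)
  then show ?thesis
    unfolding reach_prog_def reach_time_def reaches_iff_reaches_from
    by (intro runs_Seq[OF runs_Put order.refl]) (simp_all add: \<sigma>1_def)
qed

end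


section \<open>Computing a search order\<close>

text \<open>
  Array 9 marks the enqueued vertices with 2 and the two excluded terminals with 1, array 10 holds
  the queue and array 11 its length.
\<close>

definition queue :: "state \<Rightarrow> nat list" where
  "queue \<sigma> = map (\<sigma> 10) [0..<\<sigma> 11 0]"

definition push_prog :: "aexp \<Rightarrow> com" where
  "push_prog e = Seq (Put 10 (var 11) e)
     (Seq (Put 9 e (Const 2)) (Put 11 (Const 0) (Add (var 11) (Const 1))))"

text \<open>A counted loop cannot be left early; the test for an empty queue makes every iteration
  after the first success idle.\<close>

definition root_prog :: com where
  "root_prog = For 6 (input 4)
     (Cond (Conj (Lt (var 11) (Const 1)) (Lt (Get 9 (vertex_at (var 6))) (Const 1)))
       (push_prog (vertex_at (var 6))) Skip)"

text \<open>With marks 0, 1, 2 the two comparisons with 1 separate the cases: above 1 is enqueued,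
  below 1 is neither enqueued nor a terminal. Scanning in one direction is enough, since edges are
  listed in both orientations.\<close>

definition grow_prog :: com where
  "grow_prog =
     Cond (Conj (Lt (Const 1) (Get 9 (src_at (var 8)))) (Lt (Get 9 (tgt_at (var 8))) (Const 1)))
       (push_prog (tgt_at (var 8))) Skip"

text \<open>One pass over the edges per vertex suffices, because a pass that leaves the order
  incomplete has enqueued a vertex.\<close>

definition order_prog :: com where
  "order_prog = Seq (Put 9 (input 1) (Const 1)) (Seq (Put 9 (input 2) (Const 1))
     (Seq root_prog (For 7 (input 4) (For 8 (input 5) grow_prog))))"

text \<open>Array 13 collects the separator and array 14 its size.\<close>

definition chosen :: "state \<Rightarrow> nat list" where
  "chosen \<sigma> = map (\<sigma> 13) [0..<\<sigma> 14 0]"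

text \<open>The queue is read from its last entry to its first, which is the bottom-up
  order.\<close>

abbreviation "current \<equiv> Get 10 (Sub (Sub (var 11) (Const 1)) (var 12))"

text \<open>The candidate is allowed tentatively. If a path appears, it must use the candidate,
  whose permission is then revoked and which joins the separator.\<close>

definition pick_prog :: com where
  "pick_prog = Seq (Put 2 current (Const 1)) (Seq reach_prog
     (Cond (Lt (Const 0) (var 4))
       (Seq (Put 2 current (Const 0))
         (Seq (Put 13 (var 14) current) (Put 14 (Const 0) (Add (var 14) (Const 1)))))
       Skip))"

definition output_prog :: com where
  "output_prog = Seq (Put 0 (Const 0) (Const 1))
     (Seq (For 12 (var 14) (Put 0 (Add (var 12) (Const 1)) (Get 13 (var 12))))
       (Put 1 (Const 0) (Add (var 14) (Const 1))))"

text \<open>With only \<open>s\<close> allowed, a path within the bound must be a single edge from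
  \<open>s\<close> to \<open>z\<close>; this is exactly the case without a separator.\<close>

definition separator_prog :: com where
  "separator_prog = Seq (Put 2 (input 1) (Const 1)) (Seq reach_prog
     (Cond (Lt (Const 0) (var 4))
       (Seq (Put 0 (Const 0) (Const 0)) (Put 1 (Const 0) (Const 1)))
       (Seq order_prog (Seq (For 12 (var 11) pick_prog) output_prog))))"

lemma writes_push_prog [simp]: "writes (push_prog e) = {9, 10, 11}"
  by (auto simp: push_prog_def)
lemma writes_root_prog [simp]: "writes root_prog = {6, 9, 10, 11}"
  by (auto simp: root_prog_def)
lemma writes_grow_prog [simp]: "writes grow_prog = {9, 10, 11}"
  by (auto simp: grow_prog_def)
lemma writes_order_prog [simp]: "writes order_prog = {6, 7, 8, 9, 10, 11}"
  by (auto simp: order_prog_def)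
lemma writes_pick_prog [simp]: "writes pick_prog = {2, 3, 4, 5, 6, 7, 8, 13, 14}"
  by (auto simp: pick_prog_def)

definition order_time :: "nat \<Rightarrow> nat" where
  "order_time L = 1 + (1 + ((L * (4 + 2) + 2) + (L * ((L * (4 + 2) + 2) + 2) + 2)))"

definition pick_time :: "nat \<Rightarrow> nat" where
  "pick_time L = 1 + (reach_time L + 4)"

definition output_time :: "nat \<Rightarrow> nat" where
  "output_time L = 1 + ((L * (1 + 2) + 2) + 1)"

definition separator_time :: "nat \<Rightarrow> nat" where
  "separator_time L = 1 + (reach_time L +
     (order_time L + ((L * (pick_time L + 2) + 2) + output_time L) + 1))"

text \<open>The expression is evaluated twice, the second time after array 10 has changed; the
  hypothesis makes its value stable under the writes of the program.\<close>

lemma runs_push_prog: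
  assumes "\<And>\<sigma>'. agree_off {9, 10, 11} \<sigma> \<sigma>' \<Longrightarrow> aval e \<sigma>' = v"
  shows "runs (push_prog e) \<sigma> 3 (\<lambda>\<sigma>'. queue \<sigma>' = queue \<sigma> @ [v] \<and> \<sigma>' 9 = (\<sigma> 9)(v := 2))"
proof -
  have e: "aval e \<sigma> = v" "aval e (\<sigma>(10 := f)) = v" for f
    by (rule assms; simp add: agree_off_def)+
  show ?thesis unfolding push_prog_def
    by (rule runs_Seq[where M = 1 and N = 2, OF runs_Put],
        rule runs_Seq[where M = 1 and N = 1, OF runs_Put], rule runs_Put)
      (simp_all add: e queue_def)
qed

section \<open>Correctness of the search-order program on a tree\<close>

locale tree_separator_input = separator_input +
  assumes tree: "is_tree (delete_verts (underlying G) {s, z})"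
begin

definition H :: "nat sgraph" where "H = delete_verts (underlying G) {s, z}"

lemma H_connected: "is_connected H" and H_acyclic: "\<nexists>xs. is_cycle H xs"
  using tree by (auto simp: is_tree_def H_def)

lemma sverts_H: "sverts H = tverts G - {s, z}"
  by (simp add: H_def delete_verts_def underlying_def)

lemma tedges_sym: "(u, v, i) \<in> tedges G \<longleftrightarrow> (v, u, i) \<in> tedges G"
  using G unfolding temporal_graph_def by blast

lemma sedges_H:
  "{u, v} \<in> sedges H \<longleftrightarrow> u \<notin> {s, z} \<and> v \<notin> {s, z} \<and> (\<exists>i. (u, v, i) \<in> tedges G)"
  using tedges_sym unfolding H_def delete_verts_def underlying_def
  by (auto simp: doubleton_eq_iff)

lemma sedges_H_irrefl: "{u, u} \<notin> sedges H"
  using G unfolding sedges_H temporal_graph_def by blast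

definition marks_queue :: "state \<Rightarrow> bool" where
  "marks_queue \<sigma> \<longleftrightarrow>
     (\<forall>v. \<sigma> 9 v = (if v \<in> set (queue \<sigma>) then 2 else if v = s \<or> v = z then 1 else 0))"

lemma marks_queue_upd [simp]:
  "a \<notin> {9, 10, 11} \<Longrightarrow> queue (\<sigma>(a := f)) = queue \<sigma>"
  "a \<notin> {9, 10, 11} \<Longrightarrow> marks_queue (\<sigma>(a := f)) = marks_queue \<sigma>"
  by (auto simp: marks_queue_def queue_def)

lemma marks_queue_push:
  "marks_queue \<sigma> \<Longrightarrow> queue \<sigma>' = queue \<sigma> @ [v] \<Longrightarrow> \<sigma>' 9 = (\<sigma> 9)(v := 2) \<Longrightarrow> marks_queue \<sigma>'"
  by (simp add: marks_queue_def)

lemma runs_root_prog: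
  assumes \<sigma>: "has_input \<sigma>" and L: "length vs \<le> L" and "marks_queue \<sigma>" "queue \<sigma> = []"
  shows "runs root_prog \<sigma> (L * (4 + 2) + 2) (\<lambda>\<sigma>'. marks_queue \<sigma>' \<and> search_order H (queue \<sigma>'))"
proof -
  let ?body = "Cond (Conj (Lt (var 11) (Const 1)) (Lt (Get 9 (vertex_at (var 6))) (Const 1)))
       (push_prog (vertex_at (var 6))) Skip"
  define I where "I i \<sigma>' \<longleftrightarrow> marks_queue \<sigma>' \<and>
    (if queue \<sigma>' = [] then \<forall>j<i. vs ! j \<in> {s, z} else search_order H (queue \<sigma>'))" for i \<sigma>'
  have "runs root_prog \<sigma> (L * (4 + 2) + 2) (I (length vs))"
    unfolding root_prog_def
  proof (rule runs_For[where N = 4, OF _ _ _ _ _ L])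
    fix i \<sigma>'
    assume i: "i < length vs" "\<sigma>' 6 0 = i" and I: "I i \<sigma>'"
      and agree: "agree_off (insert 6 (writes ?body)) \<sigma> \<sigma>'"
    have \<sigma>': "has_input \<sigma>'" by (rule has_input_agree[OF \<sigma> agree]) simp
    have v: "aval (vertex_at (var 6)) \<sigma>' = vs ! i" using i by (simp add: aval_vertex_at[OF \<sigma>'])
    have empty: "queue \<sigma>' = [] \<longleftrightarrow> \<sigma>' 11 0 = 0" by (simp add: queue_def)
    show "runs ?body \<sigma>' 4 (I (Suc i))"
    proof (rule runs_Cond[where N = 3])
      assume b: "bval (Conj (Lt (var 11) (Const 1)) (Lt (Get 9 (vertex_at (var 6))) (Const 1))) \<sigma>'"
      then have q: "queue \<sigma>' = []" and "\<sigma>' 9 (vs ! i) = 0" using v empty by auto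
      then have "vs ! i \<notin> {s, z}" using I by (auto simp: I_def marks_queue_def split: if_splits)
      then have root: "vs ! i \<in> sverts H" using nth_mem[OF i(1)] unfolding vs(2) sverts_H by blast
      show "runs (push_prog (vertex_at (var 6))) \<sigma>' 3 (I (Suc i))"
      proof (rule runs_weaken[OF runs_push_prog order.refl])
        fix \<sigma>'' assume a: "agree_off {9, 10, 11} \<sigma>' \<sigma>''"
        have "has_input \<sigma>''" by (rule has_input_agree[OF \<sigma>' a]) simp
        then show "aval (vertex_at (var 6)) \<sigma>'' = vs ! i"
          using i a by (simp add: aval_vertex_at agree_off_def)
      next
        fix \<sigma>'' assume "queue \<sigma>'' = queue \<sigma>' @ [vs ! i] \<and> \<sigma>'' 9 = (\<sigma>' 9)(vs ! i := 2)"
        with I q root marks_queue_push show "I (Suc i) \<sigma>''"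
          by (auto simp: I_def intro: search_order_root)
      qed
    next
      assume "\<not> bval (Conj (Lt (var 11) (Const 1)) (Lt (Get 9 (vertex_at (var 6))) (Const 1))) \<sigma>'"
      then have "queue \<sigma>' \<noteq> [] \<or> 0 < \<sigma>' 9 (vs ! i)" using v empty by auto
      then have "queue \<sigma>' = [] \<longrightarrow> vs ! i \<in> {s, z}"
        using I by (auto simp: I_def marks_queue_def split: if_splits)
      with I have "I (Suc i) \<sigma>'" by (cases "queue \<sigma>' = []") (simp_all add: I_def All_less_Suc)
      then show "runs Skip \<sigma>' 3 (I (Suc i))" by - (rule runs_Skip, simp_all)
    qed simp
  next
    fix \<sigma>' assume agree: "agree_off (insert 6 (writes ?body)) \<sigma> \<sigma>'"
    have "has_input \<sigma>'" by (rule has_input_agree[OF \<sigma> agree]) simp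
    then show "aval (input 4) \<sigma>' = length vs" by (simp add: input_header)
  next
    fix k \<sigma>' v assume "I k \<sigma>'"
    then show "I k (\<sigma>'(6 := v))" by (cases "queue \<sigma>' = []") (simp_all add: I_def)
  next
    show "I 0 \<sigma>" using assms by (simp add: I_def)
  qed simp_all
  then show ?thesis
  proof (rule runs_weaken)
    fix \<sigma>' assume I: "I (length vs) \<sigma>'"
    \<comment> \<open>A connected graph has a vertex, so the scan cannot have met terminals
      only.\<close>
    have "queue \<sigma>' \<noteq> []"
    proof
      assume "queue \<sigma>' = []"
      with I have "\<forall>j<length vs. vs ! j \<in> {s, z}" by (simp add: I_def)
      then have "set vs \<subseteq> {s, z}" by (auto simp: in_set_conv_nth)
      then have "sverts H = {}" using vs(2) by (auto simp: sverts_H)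
      with H_connected show False by (simp add: is_connected_def)
    qed
    with I show "marks_queue \<sigma>' \<and> search_order H (queue \<sigma>')" by (simp add: I_def)
  qed simp
qed

lemma runs_grow_prog:
  assumes \<sigma>: "has_input \<sigma>" and k: "\<sigma> 8 0 = k" "k < length es"
    and inv: "marks_queue \<sigma>" "search_order H (queue \<sigma>)"
  shows "runs grow_prog \<sigma> 4 (\<lambda>\<sigma>'. marks_queue \<sigma>' \<and> search_order H (queue \<sigma>') \<and>
    set (queue \<sigma>) \<subseteq> set (queue \<sigma>') \<and>
    (src (es ! k) \<in> set (queue \<sigma>) \<longrightarrow> tgt (es ! k) \<in> set (queue \<sigma>') \<union> {s, z}))"
proof -
  let ?u = "src (es ! k)" and ?w = "tgt (es ! k)"
  have u: "aval (src_at (var 8)) \<sigma> = ?u" and w: "aval (tgt_at (var 8)) \<sigma> = ?w"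
    using k by (simp_all add: aval_edge[OF \<sigma>])
  have u_iff: "1 < \<sigma> 9 ?u \<longleftrightarrow> ?u \<in> set (queue \<sigma>)"
    using inv(1) by (simp add: marks_queue_def)
  have w_iff: "\<sigma> 9 ?w < 1 \<longleftrightarrow> ?w \<notin> set (queue \<sigma>) \<union> {s, z}"
    using inv(1) by (auto simp: marks_queue_def)
  show ?thesis unfolding grow_prog_def
  proof (rule runs_Cond[where N = 3])
    assume "bval (Conj (Lt (Const 1) (Get 9 (src_at (var 8)))) (Lt (Get 9 (tgt_at (var 8))) (Const 1))) \<sigma>"
    then have uw: "?u \<in> set (queue \<sigma>)" "?w \<notin> set (queue \<sigma>)" "?w \<notin> {s, z}"
      using u w u_iff w_iff by auto
    have "?w \<in> sverts H" using edge_verts[OF edge_in[OF k(2)]] uw(3) by (simp add: sverts_H)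
    moreover have "{?u, ?w} \<in> sedges H"
      using search_order_verts[OF inv(2)] uw edge_in[OF k(2)] unfolding sedges_H sverts_H by blast
    ultimately have so: "search_order H (queue \<sigma> @ [?w])"
      by (rule search_order_snoc[OF inv(2) uw(1) _ uw(2)])
    show "runs (push_prog (tgt_at (var 8))) \<sigma> 3 (\<lambda>\<sigma>'. marks_queue \<sigma>' \<and> search_order H (queue \<sigma>') \<and>
    set (queue \<sigma>) \<subseteq> set (queue \<sigma>') \<and> (?u \<in> set (queue \<sigma>) \<longrightarrow> ?w \<in> set (queue \<sigma>') \<union> {s, z}))"
    proof (rule runs_weaken[OF runs_push_prog order.refl])
      fix \<sigma>' assume a: "agree_off {9, 10, 11} \<sigma> \<sigma>'"
      have "has_input \<sigma>'" by (rule has_input_agree[OF \<sigma> a]) simp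
      then show "aval (tgt_at (var 8)) \<sigma>' = ?w"
        using k a by (simp add: aval_edge agree_off_def)
    next
      fix \<sigma>' assume "queue \<sigma>' = queue \<sigma> @ [?w] \<and> \<sigma>' 9 = (\<sigma> 9)(?w := 2)"
      with so marks_queue_push[OF inv(1)] show "marks_queue \<sigma>' \<and> search_order H (queue \<sigma>') \<and>
        set (queue \<sigma>) \<subseteq> set (queue \<sigma>') \<and> (?u \<in> set (queue \<sigma>) \<longrightarrow> ?w \<in> set (queue \<sigma>') \<union> {s, z})"
        by auto
    qed
  next
    assume "\<not> bval (Conj (Lt (Const 1) (Get 9 (src_at (var 8)))) (Lt (Get 9 (tgt_at (var 8))) (Const 1))) \<sigma>"
    then have "?u \<in> set (queue \<sigma>) \<longrightarrow> ?w \<in> set (queue \<sigma>) \<union> {s, z}"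
      using u w u_iff w_iff by auto
    with inv show "runs Skip \<sigma> 3 (\<lambda>\<sigma>'. marks_queue \<sigma>' \<and> search_order H (queue \<sigma>') \<and>
    set (queue \<sigma>) \<subseteq> set (queue \<sigma>') \<and> (?u \<in> set (queue \<sigma>) \<longrightarrow> ?w \<in> set (queue \<sigma>') \<union> {s, z}))"
      by (intro runs_Skip) auto
  qed simp
qed

lemma search_order_closed_complete:
  assumes ws: "search_order H ws"
    and closed: "\<And>u v i. (u, v, i) \<in> tedges G \<Longrightarrow> u \<in> set ws \<Longrightarrow> v \<in> set ws \<union> {s, z}"
  shows "set ws = sverts H"
proof
  from search_order_verts[OF ws] show "set ws \<subseteq> sverts H" by blast
  from search_order_verts[OF ws] obtain r where "r \<in> set ws" "r \<in> sverts H"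
    by (metis last_in_set subsetD)
  with H_connected show "sverts H \<subseteq> set ws"
  proof (rule connected_closed_subset)
    fix u v assume "u \<in> set ws" "v \<in> sverts H" "{u, v} \<in> sedges H"
    then show "v \<in> set ws" using closed[of u v] unfolding sedges_H by blast
  qed
qed

text \<open>If the pass enqueues nothing, the queue is closed under neighbours outside
  \<open>{s, z}\<close> and, \<open>H\<close> being connected, contains every vertex. The invariant
  therefore tracks the targets of those edges whose source was enqueued before the pass.\<close>

lemma runs_grow_round:
  assumes \<sigma>: "has_input \<sigma>" and L: "length es \<le> L"
    and inv: "marks_queue \<sigma>" "search_order H (queue \<sigma>)"
  shows "runs (For 8 (input 5) grow_prog) \<sigma> (L * (4 + 2) + 2)
    (\<lambda>\<sigma>'. marks_queue \<sigma>' \<and> search_order H (queue \<sigma>') \<and>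
      (length (queue \<sigma>) < length (queue \<sigma>') \<or> set (queue \<sigma>') = sverts H))"
proof -
  define I where "I k \<sigma>' \<longleftrightarrow> marks_queue \<sigma>' \<and> search_order H (queue \<sigma>') \<and>
      set (queue \<sigma>) \<subseteq> set (queue \<sigma>') \<and>
      (\<forall>j<k. src (es ! j) \<in> set (queue \<sigma>) \<longrightarrow> tgt (es ! j) \<in> set (queue \<sigma>') \<union> {s, z})" for k \<sigma>'
  have "runs (For 8 (input 5) grow_prog) \<sigma> (L * (4 + 2) + 2) (I (length es))"
  proof (rule runs_For[where N = 4, OF _ _ _ _ _ L])
    fix k \<sigma>' assume k: "k < length es" "\<sigma>' 8 0 = k"
      and agree: "agree_off (insert 8 (writes grow_prog)) \<sigma> \<sigma>'" and I: "I k \<sigma>'"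
    have \<sigma>': "has_input \<sigma>'" by (rule has_input_agree[OF \<sigma> agree]) simp
    have m: "marks_queue \<sigma>'" and so: "search_order H (queue \<sigma>')" using I by (auto simp: I_def)
    show "runs grow_prog \<sigma>' 4 (I (Suc k))"
    proof (rule runs_weaken[OF runs_grow_prog[OF \<sigma>' k(2,1) m so] order.refl])
      fix \<sigma>'' assume *: "marks_queue \<sigma>'' \<and> search_order H (queue \<sigma>'') \<and>
        set (queue \<sigma>') \<subseteq> set (queue \<sigma>'') \<and>
        (src (es ! k) \<in> set (queue \<sigma>') \<longrightarrow> tgt (es ! k) \<in> set (queue \<sigma>'') \<union> {s, z})"
      have "tgt (es ! j) \<in> set (queue \<sigma>'') \<union> {s, z}"
        if "j < Suc k" "src (es ! j) \<in> set (queue \<sigma>)" for j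
        using that * I by (cases "j = k") (auto simp: I_def less_Suc_eq)
      with * I show "I (Suc k) \<sigma>''" unfolding I_def by blast
    qed
  next
    fix \<sigma>' assume agree: "agree_off (insert 8 (writes grow_prog)) \<sigma> \<sigma>'"
    have "has_input \<sigma>'" by (rule has_input_agree[OF \<sigma> agree]) simp
    then show "aval (input 5) \<sigma>' = length es" by (simp add: input_header)
  next
    fix k \<sigma>' v assume "I k \<sigma>'"
    then show "I k (\<sigma>'(8 := v))" by (simp add: I_def)
  next
    show "I 0 \<sigma>" using inv by (simp add: I_def)
  qed simp_all
  then show ?thesis
  proof (rule runs_weaken)
    fix \<sigma>' assume I: "I (length es) \<sigma>'"
    then have so: "search_order H (queue \<sigma>')" and sub: "set (queue \<sigma>) \<subseteq> set (queue \<sigma>')"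
      by (auto simp: I_def)
    have len: "length (queue \<sigma>'') = card (set (queue \<sigma>''))" if "search_order H (queue \<sigma>'')" for \<sigma>''
      using search_order_distinct[OF that] by (simp add: distinct_card)
    have "length (queue \<sigma>) < length (queue \<sigma>') \<or> set (queue \<sigma>') = sverts H"
    proof (cases "set (queue \<sigma>) = set (queue \<sigma>')")
      case True
      have "set (queue \<sigma>') = sverts H"
      proof (rule search_order_closed_complete[OF so])
        fix u v i assume "(u, v, i) \<in> tedges G" "u \<in> set (queue \<sigma>')"
        with edge_index[of u v i] I True show "v \<in> set (queue \<sigma>') \<union> {s, z}"
          by (auto simp: I_def)
      qed
      then show ?thesis by simp
    next
      case False
      with sub have "card (set (queue \<sigma>)) < card (set (queue \<sigma>'))" by (intro psubset_card_mono) auto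
      with len[OF so] len[OF inv(2)] show ?thesis by simp
    qed
    with I show "marks_queue \<sigma>' \<and> search_order H (queue \<sigma>') \<and>
      (length (queue \<sigma>) < length (queue \<sigma>') \<or> set (queue \<sigma>') = sverts H)" by (simp add: I_def)
  qed simp
qed

lemma search_order_length:
  assumes "search_order H ws"
  shows "length ws \<le> length vs"
proof -
  have "length ws = card (set ws)" using search_order_distinct[OF assms] by (simp add: distinct_card)
  also have "\<dots> \<le> card (set vs)"
    using search_order_verts[OF assms] vs(2) by (intro card_mono[OF finite_set]) (auto simp: sverts_H)
  also have "\<dots> \<le> length vs" by (rule card_length)
  finally show ?thesis .
qed

lemma runs_order_prog:
  assumes \<sigma>: "has_input \<sigma>" and L: "length es \<le> L" "length vs \<le> L"
    and init: "\<And>v. \<sigma> 9 v = 0" "\<sigma> 11 0 = 0"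
  shows "runs order_prog \<sigma> (order_time L)
    (\<lambda>\<sigma>'. search_order H (queue \<sigma>') \<and> set (queue \<sigma>') = sverts H)"
proof -
  define \<sigma>1 where "\<sigma>1 = \<sigma>(9 := (\<sigma> 9)(s := 1, z := 1))"
  have in1: "has_input \<sigma>1" using \<sigma> by (simp add: \<sigma>1_def)
  have q1: "queue \<sigma>1 = []" "marks_queue \<sigma>1"
    using init by (auto simp: \<sigma>1_def queue_def marks_queue_def)
  have rest: "runs (Seq root_prog (For 7 (input 4) (For 8 (input 5) grow_prog))) \<sigma>1
      ((L * (4 + 2) + 2) + (L * ((L * (4 + 2) + 2) + 2) + 2))
      (\<lambda>\<sigma>'. search_order H (queue \<sigma>') \<and> set (queue \<sigma>') = sverts H)"
  proof (rule runs_Seq[OF runs_weaken_frame[OF runs_root_prog[OF in1 L(2) q1(2,1)] order.refl] order.refl])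
    fix \<sigma>2 assume inv2: "marks_queue \<sigma>2 \<and> search_order H (queue \<sigma>2)"
      and agree2: "agree_off (writes root_prog) \<sigma>1 \<sigma>2"
    have in2: "has_input \<sigma>2" by (rule has_input_agree[OF in1 agree2]) simp
    \<comment> \<open>After as many rounds as vertices the first alternative would make the queue
      longer than the vertex list, so the second one holds.\<close>
    define I where "I r \<sigma>' \<longleftrightarrow> marks_queue \<sigma>' \<and> search_order H (queue \<sigma>') \<and>
      (r < length (queue \<sigma>') \<or> set (queue \<sigma>') = sverts H)" for r \<sigma>'
    have "runs (For 7 (input 4) (For 8 (input 5) grow_prog)) \<sigma>2
      (L * ((L * (4 + 2) + 2) + 2) + 2) (I (length vs))"
    proof (rule runs_For[where N = "L * (4 + 2) + 2", OF _ _ _ _ _ L(2)])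
      show "I 0 \<sigma>2" using inv2 search_order_verts[of H "queue \<sigma>2"] by (simp add: I_def)
    next
      fix r \<sigma>'
      assume agree: "agree_off (insert 7 (writes (For 8 (input 5) grow_prog))) \<sigma>2 \<sigma>'"
        and I: "I r \<sigma>'"
      have \<sigma>': "has_input \<sigma>'" by (rule has_input_agree[OF in2 agree]) simp
      have m: "marks_queue \<sigma>'" and so: "search_order H (queue \<sigma>')" using I by (auto simp: I_def)
      show "runs (For 8 (input 5) grow_prog) \<sigma>' (L * (4 + 2) + 2) (I (Suc r))"
      proof (rule runs_weaken[OF runs_grow_round[OF \<sigma>' L(1) m so] order.refl])
        fix \<sigma>'' assume *: "marks_queue \<sigma>'' \<and> search_order H (queue \<sigma>'') \<and>
          (length (queue \<sigma>') < length (queue \<sigma>'') \<or> set (queue \<sigma>'') = sverts H)"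
        \<comment> \<open>A complete queue stays complete: it repeats no vertex and hence cannot
          grow.\<close>
        have "\<not> length (queue \<sigma>') < length (queue \<sigma>'')" if full: "set (queue \<sigma>') = sverts H"
        proof -
          have "length (queue \<sigma>'') = card (set (queue \<sigma>''))"
            using * search_order_distinct[of H "queue \<sigma>''"] by (simp add: distinct_card)
          also have "\<dots> \<le> card (set (queue \<sigma>'))"
            using * search_order_verts[of H "queue \<sigma>''"] full by (intro card_mono[OF finite_set]) blast
          also have "\<dots> \<le> length (queue \<sigma>')" by (rule card_length)
          finally show ?thesis by simp
        qed
        with * I show "I (Suc r) \<sigma>''" by (auto simp: I_def)
      qed
    next
      fix \<sigma>' assume agree: "agree_off (insert 7 (writes (For 8 (input 5) grow_prog))) \<sigma>2 \<sigma>'"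
      have "has_input \<sigma>'" by (rule has_input_agree[OF in2 agree]) simp
      then show "aval (input 4) \<sigma>' = length vs" by (simp add: input_header)
    next
      fix k \<sigma>' v assume "I k \<sigma>'"
      then show "I k (\<sigma>'(7 := v))" by (simp add: I_def)
    qed simp_all
    then show "runs (For 7 (input 4) (For 8 (input 5) grow_prog)) \<sigma>2
      (L * ((L * (4 + 2) + 2) + 2) + 2)
      (\<lambda>\<sigma>'. search_order H (queue \<sigma>') \<and> set (queue \<sigma>') = sverts H)"
      by (rule runs_weaken) (use search_order_length in \<open>fastforce simp: I_def\<close>)+
  qed
  have "runs (Seq (Put 9 (input 2) (Const 1))
      (Seq root_prog (For 7 (input 4) (For 8 (input 5) grow_prog)))) (\<sigma>(9 := (\<sigma> 9)(s := 1)))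
      (1 + ((L * (4 + 2) + 2) + (L * ((L * (4 + 2) + 2) + 2) + 2)))
      (\<lambda>\<sigma>'. search_order H (queue \<sigma>') \<and> set (queue \<sigma>') = sverts H)"
    by (rule runs_Seq[OF runs_Put order.refl])
      (use rest input_header[OF \<sigma>] in \<open>simp_all add: \<sigma>1_def\<close>)
  then show ?thesis
    unfolding order_prog_def order_time_def
    by - (rule runs_Seq[OF runs_Put order.refl], simp_all add: input_header[OF \<sigma>])
qed

section \<open>Greedy choice of the separator\<close>

text \<open>The vertices strictly between \<open>s\<close> and \<open>z\<close>, since
  \<open>z\<close> is never a source on such a path. A single edge from \<open>s\<close> to
  \<open>z\<close> contributes the empty set.\<close>

definition interiors :: "nat set set" where
  "interiors = {src ` set p - {s} | p lo x. tpath (tedges G) s lo z x p \<and> x < lo + t}"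

lemma reaches_iff_interior:
  "s \<in> A \<Longrightarrow> reaches (tedges G) s z t A \<longleftrightarrow> (\<exists>X\<in>interiors. X \<subseteq> A)"
  unfolding reaches_def interiors_def by blast

lemma interior_cut_connected:
  assumes "X \<in> interiors"
  shows "cut_connected (\<lambda>a b. {a, b} \<in> sedges H) X" "X \<subseteq> sverts H"
proof -
  from assms obtain p lo x where X: "X = src ` set p - {s}" and p: "tpath (tedges G) s lo z x p"
    unfolding interiors_def by blast
  have adj: "{a, b} \<in> sedges H" if "(a, b, i) \<in> tedges G" "a \<notin> {s, z}" "b \<notin> {s, z}" for a b i
    using that unfolding sedges_H by blast
  show "cut_connected (\<lambda>a b. {a, b} \<in> sedges H) X"
    unfolding X by (rule tpath_interior_cut_connected(1)[OF p sz]) (rule adj)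
  have z_notin: "z \<notin> src ` set p"
    by (rule tpath_interior_cut_connected(2)[OF p sz, where adj = "\<lambda>_ _. True"]) simp
  show "X \<subseteq> sverts H"
  proof
    fix a assume "a \<in> X"
    then obtain b i where e: "(a, b, i) \<in> set p" "a \<noteq> s" using X by auto
    then have "a \<noteq> z" using z_notin by force
    with e show "a \<in> sverts H" using tpath_edges[OF p] edge_verts[of a b i] by (auto simp: sverts_H)
  qed
qed

text \<open>
  The vertex of minimum rank of an interior is its top in the tree rooted at the first vertex of
  the search order.
\<close>

lemma interiors_meet:
  assumes ws: "search_order H ws" "set ws = sverts H" and rk: "\<And>i. i < length ws \<Longrightarrow> rk (ws ! i) = i"
    and X: "X \<in> interiors" "v \<in> X" "\<And>y. y \<in> X \<Longrightarrow> rk v \<le> rk y"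
    and Y: "Y \<in> interiors" "w \<in> Y" "\<And>y. y \<in> Y \<Longrightarrow> rk w \<le> rk y"
    and less: "rk v < rk w" and meet: "X \<inter> Y \<noteq> {}"
  shows "w \<in> X"
proof -
  let ?adj = "\<lambda>a b. {a, b} \<in> sedges H"
  define par where "par = {(a, b). ?adj a b \<and> rk b < rk a \<and> a \<in> sverts H \<and> b \<in> sverts H}"
  have nth: "\<exists>i<length ws. a = ws ! i \<and> rk a = i" if a: "a \<in> sverts H" for a
  proof -
    from a obtain i where i: "i < length ws" "ws ! i = a"
      unfolding ws(2)[symmetric] in_set_conv_nth by blast
    with rk[OF i(1)] show ?thesis by (intro exI[of _ i]) simp
  qed
  have inj: "inj_on rk (sverts H)"
  proof (rule inj_onI)
    fix a b assume "a \<in> sverts H" "b \<in> sverts H" "rk a = rk b"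
    with nth[of a] nth[of b] show "a = b" by auto
  qed
  have sv: "single_valued par"
  proof (rule single_valuedI)
    fix a b c assume "(a, b) \<in> par" "(a, c) \<in> par"
    then have ab: "?adj a b" "?adj a c" "rk b < rk a" "rk c < rk a"
      and V: "a \<in> sverts H" "b \<in> sverts H" "c \<in> sverts H" by (auto simp: par_def)
    have "ws ! rk a = a" "rk a < length ws" "ws ! rk b = b" "ws ! rk c = c"
      using nth[OF V(1)] nth[OF V(2)] nth[OF V(3)] by auto
    with ab have "rk b = rk c"
      by (intro search_order_unique_earlier_neighbour[OF ws(1) H_acyclic, of "rk a"]) simp_all
    with inj V(2,3) show "b = c" by (simp add: inj_on_eq_iff)
  qed
  have symp: "symp ?adj" by (auto intro: sympI simp: insert_commute)
  from meet obtain x where x: "x \<in> X" "x \<in> Y" by blast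
  have desc: "(x, y) \<in> (par \<inter> Z \<times> Z)\<^sup>*"
    if "Z \<in> interiors" "y \<in> Z" "\<And>y'. y' \<in> Z \<Longrightarrow> rk y \<le> rk y'" "x \<in> Z" for Z y
    using interior_cut_connected[OF that(1)] inj that sv sedges_H_irrefl
    by (intro cut_connected_descends_to_minimum[OF _ symp _ _ _ par_def _ sv])
      (auto intro: inj_on_subset)
  \<comment> \<open>A common vertex \<open>x\<close> climbs to \<open>w\<close> inside
    \<open>Y\<close> and to \<open>v\<close> inside \<open>X\<close>. Both climbs follow the unique
    chain of parents, on which \<open>w\<close>, having the larger rank, precedes \<open>v\<close>;
    so the climb inside \<open>X\<close> passes through \<open>w\<close>.\<close>
  have "(x, w) \<in> par\<^sup>*"
    using desc[OF Y x(2)] rtrancl_mono[OF Int_lower1] by blast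
  then show ?thesis
    by (intro min_rank_meets[OF sv _ desc[OF X x(1)] x(1) _ less]) (auto simp: par_def)
qed

text \<open>The processed vertices are the last \<open>k\<close> of the order. The next one,
  \<open>v\<close>, has smaller rank than all of them and is thus the top of any interior it
  completes.\<close>

lemma greedy_step:
  assumes ws: "search_order H ws" "set ws = sverts H" and rk: "\<And>i. i < length ws \<Longrightarrow> rk (ws ! i) = i"
    and k: "k < length ws" and v: "v = ws ! (length ws - 1 - k)"
    and inv: "greedy_inv interiors rk A S" "A \<union> S = set (drop (length ws - k) ws)"
  shows "v \<notin> A \<union> S" "insert v (A \<union> S) = set (drop (length ws - Suc k) ws)" "v \<in> sverts H"
    "if \<exists>X\<in>interiors. X \<subseteq> insert v A then greedy_inv interiors rk A (insert v S)
     else greedy_inv interiors rk (insert v A) S"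
proof -
  define m where "m = length ws - 1 - k"
  have m: "m < length ws" "length ws - k = Suc m" "length ws - Suc k = m" "v = ws ! m"
    using k v by (auto simp: m_def)
  have d: "drop m ws = v # drop (Suc m) ws" using Cons_nth_drop_Suc[OF m(1)] m(4) by simp
  have AS: "A \<union> S = set (drop (Suc m) ws)" using inv(2) unfolding m(2) .
  have "distinct (drop m ws)" using search_order_distinct[OF ws(1)] by simp
  then show new: "v \<notin> A \<union> S" unfolding AS d by simp
  show "insert v (A \<union> S) = set (drop (length ws - Suc k) ws)" unfolding AS m(3) d by simp
  show "v \<in> sverts H" using nth_mem[OF m(1)] unfolding m(4) ws(2) .
  have later: "rk v < rk y" if "y \<in> A \<union> S" for y
  proof -
    from that obtain j where j: "j < length (drop (Suc m) ws)" "y = drop (Suc m) ws ! j"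
      unfolding AS in_set_conv_nth by blast
    then have "y = ws ! (Suc m + j)" "Suc m + j < length ws" by simp_all
    with rk[of "Suc m + j"] rk[OF m(1)] show ?thesis by (simp add: m(4))
  qed
  show "if \<exists>X\<in>interiors. X \<subseteq> insert v A then greedy_inv interiors rk A (insert v S)
     else greedy_inv interiors rk (insert v A) S"
  proof (cases "\<exists>X\<in>interiors. X \<subseteq> insert v A")
    case True
    then obtain X where X: "X \<in> interiors" "X \<subseteq> insert v A" by blast
    have "greedy_inv interiors rk A (insert v S)"
    proof (rule greedy_inv_take[OF inv(1) _ _ later X])
      show "v \<notin> A" "v \<notin> S" using new by auto
    next
      fix X Y w
      assume "X \<in> interiors" "Y \<in> interiors" "v \<in> X" "\<And>y. y \<in> X \<Longrightarrow> rk v \<le> rk y" "w \<in> Y"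
        "\<And>y. y \<in> Y \<Longrightarrow> rk w \<le> rk y" "rk v < rk w" "X \<inter> Y \<noteq> {}"
      then show "w \<in> X" by (intro interiors_meet[OF ws rk, of X v Y w]) simp_all
    qed
    with True show ?thesis by simp
  next
    case False
    have "v \<notin> S" using new by simp
    moreover have "\<forall>X\<in>interiors. \<not> X \<subseteq> insert v A" using False by blast
    ultimately have "greedy_inv interiors rk (insert v A) S" by (rule greedy_inv_keep[OF inv(1)])
    with False show ?thesis by simp
  qed
qed

text \<open>Once all tree vertices are processed, an interior that avoids \<open>S\<close> lies in
  \<open>A\<close>, which the invariant excludes.\<close>

lemma greedy_correct:
  assumes inv: "greedy_inv interiors rk A S" and AS: "A \<union> S = sverts H"
  shows "is_minimum_separator G s z t S"
  unfolding is_minimum_separator_def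
proof (intro conjI allI impI)
  have "\<not> reaches (tedges G) s z t (- S)"
  proof
    assume "reaches (tedges G) s z t (- S)"
    moreover have "s \<in> - S" using AS by (auto simp: sverts_H)
    ultimately obtain X where X: "X \<in> interiors" "X \<subseteq> - S" using reaches_iff_interior[of "- S"] by blast
    with interior_cut_connected(2)[OF X(1)] AS have "X \<subseteq> A" by blast
    with X(1) inv show False by (auto simp: greedy_inv_def)
  qed
  then show "is_separator G s z t S"
    using AS sverts_H by (auto simp: is_separator_iff_not_reaches[OF sz])
next
  fix S' assume S': "is_separator G s z t S'"
  then have S'_sub: "S' \<subseteq> tverts G - {s, z}" and nr: "\<not> reaches (tedges G) s z t (- S')"
    by (auto simp: is_separator_iff_not_reaches[OF sz])
  show "card S \<le> card S'"
  proof (rule greedy_inv_minimum[OF inv])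
    show "finite S'" using S'_sub G finite_subset unfolding temporal_graph_def by blast
    fix X assume "X \<in> interiors"
    with nr S'_sub reaches_iff_interior[of "- S'"] show "S' \<inter> X \<noteq> {}" by blast
  qed
qed

section \<open>The greedy program and its output\<close>

text \<open>Array 2 keeps \<open>s\<close> marked for the reachability test, whereas interiors
  exclude \<open>s\<close>; the set of the greedy invariant is therefore the marked set minus
  \<open>s\<close>.\<close>

definition pick_inv :: "(nat \<Rightarrow> nat) \<Rightarrow> nat list \<Rightarrow> nat \<Rightarrow> state \<Rightarrow> bool" where
  "pick_inv rk ws k \<sigma> \<longleftrightarrow> 0 < \<sigma> 2 s \<and> distinct (chosen \<sigma>) \<and>
     ({v. 0 < \<sigma> 2 v} - {s}) \<union> set (chosen \<sigma>) = set (drop (length ws - k) ws) \<and>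
     greedy_inv interiors rk ({v. 0 < \<sigma> 2 v} - {s}) (set (chosen \<sigma>))"

lemma interior_insert_source: "X \<in> interiors \<Longrightarrow> X \<subseteq> A \<longleftrightarrow> X \<subseteq> A - {s}"
  using interior_cut_connected(2) by (auto simp: sverts_H)

lemma runs_pick_prog:
  assumes \<sigma>: "has_input \<sigma>" and L: "length es \<le> L" "length vs \<le> L"
    and ws: "search_order H ws" "set ws = sverts H" "queue \<sigma> = ws"
    and rk: "\<And>i. i < length ws \<Longrightarrow> rk (ws ! i) = i"
    and k: "\<sigma> 12 0 = k" "k < length ws" and inv: "pick_inv rk ws k \<sigma>"
  shows "runs pick_prog \<sigma> (pick_time L) (pick_inv rk ws (Suc k))"
proof -
  define v where "v = ws ! (length ws - 1 - k)"
  have len: "\<sigma> 11 0 = length ws" using ws(3) by (auto simp: queue_def)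
  have nth: "\<sigma> 10 i = ws ! i" if "i < length ws" for i
  proof -
    have "queue \<sigma> ! i = \<sigma> 10 i" using that len by (simp add: queue_def)
    then show ?thesis unfolding ws(3) by simp
  qed
  have cur: "aval current \<sigma>' = v" if "\<sigma>' 10 = \<sigma> 10" "\<sigma>' 11 = \<sigma> 11" "\<sigma>' 12 = \<sigma> 12" for \<sigma>'
  proof -
    have "aval current \<sigma>' = \<sigma> 10 (length ws - 1 - k)" using that len k(1) by simp
    also have "\<dots> = v" unfolding v_def by (rule nth) (use k(2) in simp)
    finally show ?thesis .
  qed
  let ?A = "{v. 0 < \<sigma> 2 v} - {s}" and ?S = "set (chosen \<sigma>)"
  have inv': "greedy_inv interiors rk ?A ?S" "?A \<union> ?S = set (drop (length ws - k) ws)"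
    "0 < \<sigma> 2 s" "distinct (chosen \<sigma>)"
    using inv unfolding pick_inv_def by auto
  note step = greedy_step[OF ws(1,2) rk k(2) v_def inv'(1,2)]
  have vs: "v \<noteq> s" using step(3) by (auto simp: sverts_H)
  define \<sigma>1 where "\<sigma>1 = \<sigma>(2 := (\<sigma> 2)(v := 1))"
  have in1: "has_input \<sigma>1" using \<sigma> by (simp add: \<sigma>1_def)
  have A1: "{v. 0 < \<sigma>1 2 v} - {s} = insert v ?A" using vs by (auto simp: \<sigma>1_def)
  \<comment> \<open>As \<open>s\<close> is marked throughout, the test asks exactly whether
    \<open>v\<close> completes an interior.\<close>
  have reach: "reaches (tedges G) s z t {v. 0 < \<sigma>1 2 v} \<longleftrightarrow> (\<exists>X\<in>interiors. X \<subseteq> insert v ?A)"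
    using inv'(3) vs interior_insert_source[of _ "{v. 0 < \<sigma>1 2 v}"] unfolding A1[symmetric]
    by (subst reaches_iff_interior) (auto simp: \<sigma>1_def)
  have rest: "runs (Seq reach_prog
     (Cond (Lt (Const 0) (var 4))
       (Seq (Put 2 current (Const 0))
         (Seq (Put 13 (var 14) current) (Put 14 (Const 0) (Add (var 14) (Const 1)))))
       Skip)) \<sigma>1 (reach_time L + 4) (pick_inv rk ws (Suc k))"
  proof (rule runs_Seq[OF runs_weaken_frame[OF runs_reach_prog[OF in1 L] order.refl] order.refl])
    fix \<sigma>2 :: state
    assume verdict: "\<sigma>2 4 0 = (if reaches (tedges G) s z t {v. 0 < \<sigma>1 2 v} then 1 else 0)"
      and agree2: "agree_off (writes reach_prog) \<sigma>1 \<sigma>2"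
    have same: "\<sigma>2 2 = (\<sigma> 2)(v := 1)" "\<sigma>2 10 = \<sigma> 10" "\<sigma>2 11 = \<sigma> 11" "\<sigma>2 12 = \<sigma> 12"
      "\<sigma>2 13 = \<sigma> 13" "\<sigma>2 14 = \<sigma> 14"
      using agree2 by (simp_all add: agree_off_def \<sigma>1_def)
    show "runs (Cond (Lt (Const 0) (var 4))
       (Seq (Put 2 current (Const 0))
         (Seq (Put 13 (var 14) current) (Put 14 (Const 0) (Add (var 14) (Const 1)))))
       Skip) \<sigma>2 4 (pick_inv rk ws (Suc k))"
    proof (rule runs_Cond[where N = 3])
      assume "bval (Lt (Const 0) (var 4)) \<sigma>2"
      then have hit: "\<exists>X\<in>interiors. X \<subseteq> insert v ?A"
        using verdict reach by (simp split: if_splits)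
      define \<sigma>3 where "\<sigma>3 = \<sigma>2(2 := (\<sigma>2 2)(v := 0), 13 := (\<sigma>2 13)(\<sigma> 14 0 := v),
          14 := (\<sigma>2 14)(0 := Suc (\<sigma> 14 0)))"
      have ch: "chosen \<sigma>3 = chosen \<sigma> @ [v]" by (simp add: chosen_def \<sigma>3_def same)
      have "{v. 0 < \<sigma>3 2 v} - {s} = ?A" using step(1) vs by (auto simp: \<sigma>3_def same)
      then have "pick_inv rk ws (Suc k) \<sigma>3"
        using step hit inv'(3,4) vs ch unfolding pick_inv_def by (simp add: \<sigma>3_def same)
      moreover have "\<sigma>2(2 := (\<sigma>2 2)(aval current \<sigma>2 := 0)) = \<sigma>2(2 := (\<sigma>2 2)(v := 0))"
        using cur[of \<sigma>2] same by simp
      ultimately show "runs (Seq (Put 2 current (Const 0))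
         (Seq (Put 13 (var 14) current) (Put 14 (Const 0) (Add (var 14) (Const 1))))) \<sigma>2 3
         (pick_inv rk ws (Suc k))"
        using cur[of "\<sigma>2(2 := (\<sigma>2 2)(v := 0))"] same
        by (intro runs_Seq[where M = 1 and N = 2, OF runs_Put]
            runs_Seq[where M = 1 and N = 1, OF runs_Put] runs_Put) (simp_all add: \<sigma>3_def)
    next
      assume "\<not> bval (Lt (Const 0) (var 4)) \<sigma>2"
      then have hit: "\<not> (\<exists>X\<in>interiors. X \<subseteq> insert v ?A)"
        using verdict reach by (simp split: if_splits)
      have ch: "chosen \<sigma>2 = chosen \<sigma>" by (simp add: chosen_def same)
      have "{v. 0 < \<sigma>2 2 v} - {s} = insert v ?A" using A1 by (simp add: same \<sigma>1_def)
      then have "pick_inv rk ws (Suc k) \<sigma>2"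
        using step hit inv'(3,4) vs ch unfolding pick_inv_def by (simp add: same)
      then show "runs Skip \<sigma>2 3 (pick_inv rk ws (Suc k))" by - (rule runs_Skip, simp_all)
    qed simp
  qed
  have "\<sigma>(2 := (\<sigma> 2)(aval current \<sigma> := 1)) = \<sigma>1" using cur[of \<sigma>] by (simp add: \<sigma>1_def)
  with rest show ?thesis
    unfolding pick_prog_def pick_time_def
    by - (rule runs_Seq[OF runs_Put order.refl], simp_all)
qed

text \<open>The answer overwrites the input in array 0; what remains of the input lies beyond the
  announced length and is not part of the result.\<close>

lemma runs_output_prog:
  assumes "length (chosen \<sigma>) \<le> L"
  shows "runs output_prog \<sigma> (output_time L) (\<lambda>\<sigma>'. result \<sigma>' = 1 # chosen \<sigma>)"
proof -
  define \<sigma>1 where "\<sigma>1 = \<sigma>(0 := (\<sigma> 0)(0 := 1))"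
  have len: "\<sigma> 14 0 \<le> L" using assms by (simp add: chosen_def)
  let ?body = "Put 0 (Add (var 12) (Const 1)) (Get 13 (var 12))"
  have copy: "runs (For 12 (var 14) ?body) \<sigma>1 (L * (1 + 2) + 2)
      (\<lambda>\<sigma>'. \<sigma>' 0 0 = 1 \<and> (\<forall>j<\<sigma> 14 0. \<sigma>' 0 (Suc j) = \<sigma> 13 j))"
    by (rule runs_For[where N = 1, OF _ _ _ _ _ len, where
          I = "\<lambda>k \<sigma>'. \<sigma>' 0 0 = 1 \<and> (\<forall>j<k. \<sigma>' 0 (Suc j) = \<sigma> 13 j)"])
      (auto intro!: runs_Put simp: \<sigma>1_def agree_off_def less_Suc_eq)
  have "runs (Seq (For 12 (var 14) ?body) (Put 1 (Const 0) (Add (var 14) (Const 1)))) \<sigma>1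
      ((L * (1 + 2) + 2) + 1) (\<lambda>\<sigma>'. result \<sigma>' = 1 # chosen \<sigma>)"
  proof (rule runs_Seq[OF runs_weaken_frame[OF copy order.refl] order.refl])
    fix \<sigma>2 assume *: "\<sigma>2 0 0 = 1 \<and> (\<forall>j<\<sigma> 14 0. \<sigma>2 0 (Suc j) = \<sigma> 13 j)"
      and agree: "agree_off (writes (For 12 (var 14) ?body)) \<sigma>1 \<sigma>2"
    have "\<sigma>2 14 0 = \<sigma> 14 0" using agree by (simp add: agree_off_def \<sigma>1_def)
    with * show "runs (Put 1 (Const 0) (Add (var 14) (Const 1))) \<sigma>2 1 (\<lambda>\<sigma>'. result \<sigma>' = 1 # chosen \<sigma>)"
      by (intro runs_Put)
        (auto simp: result_def chosen_def map_upt_Suc simp del: upt_Suc)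
  qed
  then show ?thesis
    unfolding output_prog_def output_time_def
    by - (rule runs_Seq[OF runs_Put order.refl], simp_all add: \<sigma>1_def)
qed

lemma runs_greedy:
  assumes \<sigma>: "has_input \<sigma>" and L: "length es \<le> L" "length vs \<le> L"
    and ws: "search_order H (queue \<sigma>)" "set (queue \<sigma>) = sverts H"
    and init: "\<And>v. 0 < \<sigma> 2 v \<longleftrightarrow> v = s" "\<sigma> 14 0 = 0"
    and nr: "\<not> reaches (tedges G) s z t {s}"
  shows "runs (Seq (For 12 (var 11) pick_prog) output_prog) \<sigma>
    ((L * (pick_time L + 2) + 2) + output_time L)
    (\<lambda>\<sigma>'. \<exists>ss. result \<sigma>' = 1 # ss \<and> distinct ss \<and> is_minimum_separator G s z t (set ss) \<and>
      length ss \<le> L)"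
proof -
  let ?ws = "queue \<sigma>"
  have dist: "distinct ?ws" by (rule search_order_distinct[OF ws(1)])
  define rk where "rk v = (THE i. i < length ?ws \<and> ?ws ! i = v)" for v
  have rk: "rk (?ws ! i) = i" if "i < length ?ws" for i
    unfolding rk_def using that dist by (intro the_equality) (auto simp: nth_eq_iff_index_eq)
  have len: "length ?ws \<le> L" using search_order_length[OF ws(1)] L(2) by simp
  have picks: "runs (For 12 (var 11) pick_prog) \<sigma> (L * (pick_time L + 2) + 2)
      (pick_inv rk ?ws (length ?ws))"
  proof (rule runs_For[where N = "pick_time L", OF _ _ _ _ _ len])
    have "{v. 0 < \<sigma> 2 v} - {s} = {}" using init(1) by auto
    \<comment> \<open>The negative first test says that no interior is empty, which is the base case
      of the greedy invariant.\<close>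
    moreover have "\<forall>X\<in>interiors. \<not> X \<subseteq> {}" using nr reaches_iff_interior[of "{s}"] by blast
    ultimately show "pick_inv rk ?ws 0 \<sigma>"
      using init by (simp add: pick_inv_def greedy_inv_def chosen_def)
  next
    fix k \<sigma>' assume k: "k < length ?ws" "\<sigma>' 12 0 = k"
      and agree: "agree_off (insert 12 (writes pick_prog)) \<sigma> \<sigma>'" and I: "pick_inv rk ?ws k \<sigma>'"
    have \<sigma>': "has_input \<sigma>'" by (rule has_input_agree[OF \<sigma> agree]) simp
    have "queue \<sigma>' = ?ws" using agree by (simp add: queue_def agree_off_def)
    from runs_pick_prog[OF \<sigma>' L ws this rk k(2,1) I]
    show "runs pick_prog \<sigma>' (pick_time L) (pick_inv rk ?ws (Suc k))" .
  next
    fix k \<sigma>' v assume "pick_inv rk ?ws k \<sigma>'"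
    then show "pick_inv rk ?ws k (\<sigma>'(12 := v))" by (simp add: pick_inv_def chosen_def)
  next
    fix \<sigma>' assume "agree_off (insert 12 (writes pick_prog)) \<sigma> \<sigma>'"
    then show "aval (var 11) \<sigma>' = length ?ws" by (simp add: agree_off_def queue_def)
  qed simp_all
  show ?thesis
  proof (rule runs_Seq[OF runs_weaken[OF picks order.refl] order.refl])
    fix \<sigma>' assume inv: "pick_inv rk ?ws (length ?ws) \<sigma>'"
    then have min: "is_minimum_separator G s z t (set (chosen \<sigma>'))"
      using ws(2) by (auto simp: pick_inv_def intro!: greedy_correct)
    have "length (chosen \<sigma>') = card (set (chosen \<sigma>'))"
      using inv by (simp add: pick_inv_def distinct_card)
    also have "\<dots> \<le> card (set ?ws)"
      using inv by (intro card_mono) (auto simp: pick_inv_def)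
    also have "\<dots> \<le> length ?ws" by (rule card_length)
    finally have "length (chosen \<sigma>') \<le> L" using len by simp
    from runs_output_prog[OF this] min inv this
    show "runs output_prog \<sigma>' (output_time L) (\<lambda>\<sigma>'. \<exists>ss. result \<sigma>' = 1 # ss \<and> distinct ss \<and>
        is_minimum_separator G s z t (set ss) \<and> length ss \<le> L)"
      by (elim runs_weaken) (auto simp: pick_inv_def)
  qed
qed

lemma runs_separator_prog:
  assumes L: "length es \<le> L" "length vs \<le> L"
  shows "runs separator_prog (load code) (separator_time L)
    (\<lambda>\<sigma>'. result \<sigma>' \<in> separator_answers (G, s, z, t) \<and> length (result \<sigma>') \<le> L + 1)"
proof -
  let ?post = "\<lambda>\<sigma>'. result \<sigma>' \<in> separator_answers (G, s, z, t) \<and> length (result \<sigma>') \<le> L + 1"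
  let ?N = "order_time L + ((L * (pick_time L + 2) + 2) + output_time L)"
  have in0: "has_input (load code)" by (simp add: has_input_def)
  define \<sigma>1 where "\<sigma>1 = (load code)(2 := (load code 2)(s := 1))"
  have in1: "has_input \<sigma>1" using in0 by (simp add: \<sigma>1_def)
  have A1: "0 < \<sigma>1 2 v \<longleftrightarrow> v = s" for v by (simp add: \<sigma>1_def load_def)
  have "runs (Seq reach_prog (Cond (Lt (Const 0) (var 4))
       (Seq (Put 0 (Const 0) (Const 0)) (Put 1 (Const 0) (Const 1)))
       (Seq order_prog (Seq (For 12 (var 11) pick_prog) output_prog)))) \<sigma>1
     (reach_time L + (?N + 1)) ?post"
  proof (rule runs_Seq[OF runs_weaken_frame[OF runs_reach_prog[OF in1 L] order.refl] order.refl])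
    fix \<sigma>2 :: state
    assume verdict: "\<sigma>2 4 0 = (if reaches (tedges G) s z t {v. 0 < \<sigma>1 2 v} then 1 else 0)"
      and agree2: "agree_off (writes reach_prog) \<sigma>1 \<sigma>2"
    have in2: "has_input \<sigma>2" by (rule has_input_agree[OF in1 agree2]) simp
    have same2: "\<sigma>2 2 = \<sigma>1 2" "\<sigma>2 a = \<sigma>1 a" if "8 < a" for a
      using agree2 that by (simp_all add: agree_off_def)
    have reach: "0 < \<sigma>2 4 0 \<longleftrightarrow> reaches (tedges G) s z t {s}"
      using verdict A1 by simp
    show "runs (Cond (Lt (Const 0) (var 4))
       (Seq (Put 0 (Const 0) (Const 0)) (Put 1 (Const 0) (Const 1)))
       (Seq order_prog (Seq (For 12 (var 11) pick_prog) output_prog))) \<sigma>2 (?N + 1) ?post"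
    proof (rule runs_Cond[OF _ _ order.refl])
      assume "bval (Lt (Const 0) (var 4)) \<sigma>2"
      then have "reaches (tedges G) s z t {s}" using reach by simp
      \<comment> \<open>A separator does not contain \<open>s\<close>, so its complement includes
        \<open>{s}\<close> and lets the same path through.\<close>
      then have "\<nexists>S. is_separator G s z t S"
        using reaches_mono[of "tedges G" s z t "{s}"]
        unfolding is_separator_iff_not_reaches[OF sz] by blast
      then have "[0] \<in> separator_answers (G, s, z, t)" by (simp add: separator_answers_def)
      then show "runs (Seq (Put 0 (Const 0) (Const 0)) (Put 1 (Const 0) (Const 1))) \<sigma>2 ?N ?post"
        by (intro runs_Seq[where M = 1 and N = 1, OF runs_Put] runs_Put)
          (simp_all add: result_def output_time_def)
    next
      assume "\<not> bval (Lt (Const 0) (var 4)) \<sigma>2"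
      then have nr: "\<not> reaches (tedges G) s z t {s}" using reach by simp
      have init: "\<sigma>2 9 v = 0" "\<sigma>2 11 0 = 0" for v
        by (simp_all add: same2 \<sigma>1_def load_def)
      show "runs (Seq order_prog (Seq (For 12 (var 11) pick_prog) output_prog)) \<sigma>2 ?N ?post"
      proof (rule runs_Seq[OF runs_weaken_frame[OF runs_order_prog[OF in2 L init] order.refl] order.refl])
        fix \<sigma>3 :: state
        assume ws: "search_order H (queue \<sigma>3) \<and> set (queue \<sigma>3) = sverts H"
          and agree3: "agree_off (writes order_prog) \<sigma>2 \<sigma>3"
        have in3: "has_input \<sigma>3" by (rule has_input_agree[OF in2 agree3]) simp
        have "\<sigma>3 2 = \<sigma>1 2" "\<sigma>3 14 = \<sigma>1 14"
          using agree3 same2[of 14] by (simp_all add: agree_off_def)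
        then have "0 < \<sigma>3 2 v \<longleftrightarrow> v = s" "\<sigma>3 14 0 = 0" for v
          using A1 by (simp_all add: \<sigma>1_def load_def)
        from runs_greedy[OF in3 L conjunct1[OF ws] conjunct2[OF ws] this nr]
        show "runs (Seq (For 12 (var 11) pick_prog) output_prog) \<sigma>3
            ((L * (pick_time L + 2) + 2) + output_time L) ?post"
          by (elim runs_weaken) (auto simp: separator_answers_def)
      qed
    qed
  qed
  then show ?thesis
    unfolding separator_prog_def separator_time_def
    by - (rule runs_Seq[OF runs_Put order.refl], simp_all add: \<sigma>1_def input_header[OF in0])
qed

end

section \<open>Polynomial bound in the input size\<close>

text \<open>The further bit per number in the size makes even a zero entry count for at least
  1.\<close>

lemma length_le_input_size: "length xs \<le> input_size xs"
  by (induction xs) (auto simp: input_size_def)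

text \<open>The polynomials copy the time functions over the indeterminate \<open>X\<close>, with
  sums such as \<open>4 + 2\<close> evaluated, and evaluation commutes with sums and products. The
  summand \<open>L + 1\<close> pays for the length of the output.\<close>

lemma separator_time_poly: "\<exists>q :: nat poly. \<forall>L. separator_time L + (L + 1) \<le> poly q L"
proof -
  define X :: "nat poly" where "X = [:0, 1:]"
  define W where "W = (X * 3 + 2) + (1 + ((X * ((X * 4 + 2) + 2) + 2) + 2))"
  define R where "R = 1 + (X * (W + 2) + 2)"
  define Q where "Q = 1 + (R + ((1 + (1 + ((X * 6 + 2) + (X * ((X * 6 + 2) + 2) + 2)))) +
    ((X * ((1 + (R + 4)) + 2) + 2) + (1 + ((X * 3 + 2) + 1))) + 1)) + (X + 1)"
  have "poly Q L = separator_time L + (L + 1)" for L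
    by (simp add: Q_def R_def W_def X_def separator_time_def order_time_def pick_time_def
        output_time_def reach_time_def window_time_def)
  then show ?thesis by (intro exI[of _ Q]) simp
qed

theorem theorem8:
  shows "poly_time_solvable
    {(G, s, z, t) \<in> separator_instances. is_tree (delete_verts (underlying G) {s, z})}
    separator_codes separator_answers"
proof -
  obtain q :: "nat poly" where q: "\<And>L. separator_time L + (L + 1) \<le> poly q L"
    using separator_time_poly by blast
  show ?thesis unfolding poly_time_solvable_def
  proof (intro exI[of _ separator_prog] exI[of _ q] ballI)
    fix I xs
    assume I: "I \<in> {(G, s, z, t) \<in> separator_instances. is_tree (delete_verts (underlying G) {s, z})}"
      and xs: "xs \<in> separator_codes I"
    obtain G s z t where I_eq: "I = (G, s, z, t)" by (cases I) auto
    from xs obtain vs es where code: "xs = [lifetime G, s, z, t, length vs, length es] @ vs @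
        concat (map (\<lambda>(u, v, i). [u, v, i]) es)"
      and lists: "distinct vs" "set vs = tverts G" "distinct es" "set es = tedges G"
      unfolding I_eq separator_codes_def by auto
    interpret tree_separator_input G s z t vs es
      using I lists unfolding I_eq separator_instances_def by unfold_locales auto
    have xs_code: "xs = code" by (simp add: code code_def)
    \<comment> \<open>The bounds hold for every \<open>L\<close> above both list lengths, so the
      input size itself can be inserted and no monotonicity of \<open>q\<close> has to be
      shown.\<close>
    let ?L = "input_size xs"
    have L: "length es \<le> ?L" "length vs \<le> ?L"
      using length_le_input_size[of xs] length_code xs_code by auto
    from runs_separator_prog[OF L] obtain n \<sigma> where
      "exec separator_prog (load xs) n \<sigma>" "n \<le> separator_time ?L"
      "result \<sigma> \<in> separator_answers I" "length (result \<sigma>) \<le> ?L + 1"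
      unfolding runs_def xs_code[symmetric] I_eq by blast
    with q[of ?L] show "\<exists>n \<sigma>. exec separator_prog (load xs) n \<sigma> \<and> result \<sigma> \<in> separator_answers I \<and>
        n + length (result \<sigma>) \<le> poly q ?L"
      by (intro exI[of _ n] exI[of _ \<sigma>]) auto
  qed
qed

end
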